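(* Let $\dot{G}=(G,\sigma)$ be an unbalanced signed graph of order $n$, and let $k$ be an integer with $3 \le k \le (n-11)/10$. If $\dot{G}$ is $C_{2k+1}^{-}$-free, then $$\rho(\dot{G}) \le \rho(C_{3}^{-} \cdot K_{n-2}),$$ with equality if and only if $\dot{G}$ is switching equivalent to $C_{3}^{-} \cdot K_{n-2}$.
   Context: All graphs are finite, simple and undirected. A signed graph $\dot{G}=(G,\sigma)$ is a graph $G$ together with a sign function $\sigma:E(G)\to\{+1,-1\}$. Its adjacency matrix $A(\dot{G})=(\sigma_{ij})$ has $\sigma_{ij}=\sigma(v_iv_j)$ if $v_i\sim v_j$ and $0$ otherwise; its eigenvalues are $\lambda_1(\dot G)\ge\cdots\ge\lambda_n(\dot G)$ and its spectral radius is $\rho(\dot{G})=\max\{\lambda_1(\dot G),-\lambda_n(\dot G)\}$. The sign of a cycle is the product of the signs of its edges; $C_l^-$ denotes a negative cycle of length $l$. For $U\subseteq V(G)$, switching at $U$ reverses the sign of every edge between $U$ and $V(G)\setminus U$; two signed graphs are switching equivalent if one is obtained from the other by such a switching. A signed graph is balanced if it is switching equivalent to one with all edges positive, and unbalanced otherwise. A signed graph is $C_{2k+1}^-$-free if it has no subgraph switching equivalent to $C_{2k+1}^-$ (i.e., no negative cycle of length $2k+1$). $C_3^-\cdot K_{n-2}$ denotes the signed graph obtained from a negative triangle $C_3^-$ and an all-positive complete graph $(K_{n-2},+)$ by identifying one vertex of the triangle with one vertex of $K_{n-2}$. *)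

theory Defs
  imports Complex_Main "Jordan_Normal_Form.Char_Poly"
begin

text \<open>Only the values of \<open>sg_sign\<close> on edges are meaningful.\<close>

record 'a sgraph =
  sg_verts :: "'a set"
  sg_edges :: "'a set set"
  sg_sign  :: "'a set \<Rightarrow> int"

definition signed_graph :: "'a sgraph \<Rightarrow> bool" where
  "signed_graph G \<longleftrightarrow>
     finite (sg_verts G) \<and>
     (\<forall>e\<in>sg_edges G. e \<subseteq> sg_verts G \<and> card e = 2) \<and>
     (\<forall>e\<in>sg_edges G. sg_sign G e = 1 \<or> sg_sign G e = -1)"

definition sg_order :: "'a sgraph \<Rightarrow> nat" where
  "sg_order G = card (sg_verts G)"

definition adj_entry :: "'a sgraph \<Rightarrow> 'a \<Rightarrow> 'a \<Rightarrow> real" where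
  "adj_entry G u v = (if {u, v} \<in> sg_edges G then of_int (sg_sign G {u, v}) else 0)"

text \<open>The list \<open>vs\<close> is the enumeration of the vertices that labels the rows and columns.\<close>

definition adj_matrix :: "'a sgraph \<Rightarrow> 'a list \<Rightarrow> real mat" where
  "adj_matrix G vs =
     mat (length vs) (length vs) (\<lambda>(i, j). adj_entry G (vs ! i) (vs ! j))"

definition sg_eigenvalues :: "'a sgraph \<Rightarrow> real set" where
  "sg_eigenvalues G =
     {x. \<exists>vs. distinct vs \<and> set vs = sg_verts G \<and> eigenvalue (adj_matrix G vs) x}"

definition sg_spectral_radius :: "'a sgraph \<Rightarrow> real" where
  "sg_spectral_radius G = max (Max (sg_eigenvalues G)) (- Min (sg_eigenvalues G))"

definition switch :: "'a set \<Rightarrow> 'a sgraph \<Rightarrow> 'a sgraph" where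
  "switch U G = G\<lparr>sg_sign := (\<lambda>e.
     if \<exists>u\<in>U. \<exists>v\<in>sg_verts G - U. e = {u, v} then - sg_sign G e else sg_sign G e)\<rparr>"

definition sg_isomorphic :: "'a sgraph \<Rightarrow> 'b sgraph \<Rightarrow> bool" where
  "sg_isomorphic G H \<longleftrightarrow>
     (\<exists>f. bij_betw f (sg_verts G) (sg_verts H) \<and>
          sg_edges H = (\<lambda>e. f ` e) ` sg_edges G \<and>
          (\<forall>e\<in>sg_edges G. sg_sign H (f ` e) = sg_sign G e))"

text \<open>As usual, signed graphs are identified when they are isomorphic.\<close>

definition switching_equivalent :: "'a sgraph \<Rightarrow> 'b sgraph \<Rightarrow> bool" where
  "switching_equivalent G H \<longleftrightarrow> (\<exists>U\<subseteq>sg_verts G. sg_isomorphic (switch U G) H)"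

definition balanced :: "'a sgraph \<Rightarrow> bool" where
  "balanced G \<longleftrightarrow>
     (\<exists>H :: 'a sgraph. signed_graph H \<and> switching_equivalent G H \<and>
        (\<forall>e\<in>sg_edges H. sg_sign H e = 1))"

definition cycle_edge :: "'a list \<Rightarrow> nat \<Rightarrow> 'a set" where
  "cycle_edge vs i = {vs ! i, vs ! (Suc i mod length vs)}"

definition is_cycle :: "'a sgraph \<Rightarrow> 'a list \<Rightarrow> bool" where
  "is_cycle G vs \<longleftrightarrow>
     3 \<le> length vs \<and> distinct vs \<and> set vs \<subseteq> sg_verts G \<and>
     (\<forall>i<length vs. cycle_edge vs i \<in> sg_edges G)"

definition cycle_sign :: "'a sgraph \<Rightarrow> 'a list \<Rightarrow> int" where
  "cycle_sign G vs = (\<Prod>i<length vs. sg_sign G (cycle_edge vs i))"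

definition negative_cycle_free :: "nat \<Rightarrow> 'a sgraph \<Rightarrow> bool" where
  "negative_cycle_free l G \<longleftrightarrow>
     \<not> (\<exists>vs. is_cycle G vs \<and> length vs = l \<and> cycle_sign G vs = -1)"

text \<open>
  For \<open>n \<ge> 3\<close>: the positive complete graph lives on \<open>{..<n - 2}\<close>, the triangle on
  \<open>{0, n - 2, n - 1}\<close>, and \<open>0\<close> is the identified vertex. The sign pattern chosen on the
  triangle is immaterial: switching at \<open>n - 2\<close> and \<open>n - 1\<close> gives all the others with
  negative product.
\<close>

definition C3neg_dot_K :: "nat \<Rightarrow> nat sgraph" where
  "C3neg_dot_K n =
     \<lparr>sg_verts = {..<n},
      sg_edges = {{u, v} | u v. u < n - 2 \<and> v < n - 2 \<and> u \<noteq> v}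
                 \<union> {{0, n - 2}, {0, n - 1}, {n - 2, n - 1}},
      sg_sign = (\<lambda>e. if e = {n - 2, n - 1} then -1 else 1)\<rparr>"

text \<open>The choice of enumeration in \<open>sg_eigenvalues\<close> is immaterial.\<close>

lemma eigenvalue_adj_matrix_iff:
  assumes d: "distinct vs" and V: "set vs = sg_verts G"
  shows "eigenvalue (adj_matrix G vs) x \<longleftrightarrow>
    (\<exists>f. (\<exists>v\<in>sg_verts G. f v \<noteq> 0) \<and>
         (\<forall>u\<in>sg_verts G. (\<Sum>v\<in>sg_verts G. adj_entry G u v * f v) = x * f u))"
proof -
  let ?n = "length vs" and ?A = "adj_matrix G vs"
  have carr: "?A \<in> carrier_mat ?n ?n" by (simp add: adj_matrix_def)
  have sum_V: "(\<Sum>v\<in>sg_verts G. g v) = (\<Sum>j<?n. g (vs ! j))" for g :: "'a \<Rightarrow> real"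
    using sum.reindex_bij_betw[OF bij_betw_nth[OF d refl refl], of g] V by simp
  have mult: "(?A *\<^sub>v w) $ i = (\<Sum>j<?n. adj_entry G (vs ! i) (vs ! j) * w $ j)"
    if "w \<in> carrier_vec ?n" "i < ?n" for w i
    using that by (simp add: adj_matrix_def scalar_prod_def atLeast0LessThan)
  show ?thesis
  proof
    assume "eigenvalue ?A x"
    then obtain w where w: "w \<in> carrier_vec ?n" "w \<noteq> 0\<^sub>v ?n" "?A *\<^sub>v w = x \<cdot>\<^sub>v w"
      using carr by (auto simp: eigenvalue_def eigenvector_def)
    define f where "f v = w $ (THE i. i < ?n \<and> vs ! i = v)" for v
    have f: "f (vs ! i) = w $ i" if "i < ?n" for i
    proof -
      have "(THE j. j < ?n \<and> vs ! j = vs ! i) = i"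
        using that d by (intro the_equality) (auto simp: nth_eq_iff_index_eq)
      then show ?thesis by (simp add: f_def)
    qed
    obtain i where i: "i < ?n" "w $ i \<noteq> 0"
    proof -
      have "\<exists>i<?n. w $ i \<noteq> 0"
      proof (rule ccontr)
        assume "\<not> ?thesis"
        then have "w = 0\<^sub>v ?n" using w(1) by (intro eq_vecI) auto
        with w(2) show False ..
      qed
      then show thesis using that by blast
    qed
    have "vs ! i \<in> sg_verts G" using i(1) V nth_mem by blast
    moreover have "f (vs ! i) \<noteq> 0" using i f by simp
    ultimately have "\<exists>v\<in>sg_verts G. f v \<noteq> 0" by blast
    moreover have "(\<Sum>v\<in>sg_verts G. adj_entry G u v * f v) = x * f u"
      if "u \<in> sg_verts G" for u
    proof -
      obtain i where i: "i < ?n" "u = vs ! i"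
        using \<open>u \<in> sg_verts G\<close> V by (metis in_set_conv_nth)
      have "(\<Sum>v\<in>sg_verts G. adj_entry G u v * f v) = (?A *\<^sub>v w) $ i"
        using i w(1) by (simp add: sum_V mult f)
      also have "\<dots> = x * f u" using i w by (simp add: f)
      finally show ?thesis .
    qed
    ultimately show "\<exists>f. (\<exists>v\<in>sg_verts G. f v \<noteq> 0) \<and>
         (\<forall>u\<in>sg_verts G. (\<Sum>v\<in>sg_verts G. adj_entry G u v * f v) = x * f u)" by blast
  next
    assume "\<exists>f. (\<exists>v\<in>sg_verts G. f v \<noteq> 0) \<and>
         (\<forall>u\<in>sg_verts G. (\<Sum>v\<in>sg_verts G. adj_entry G u v * f v) = x * f u)"
    then obtain f v where f: "v \<in> sg_verts G" "f v \<noteq> 0"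
      "\<And>u. u \<in> sg_verts G \<Longrightarrow> (\<Sum>v\<in>sg_verts G. adj_entry G u v * f v) = x * f u" by blast
    define w where "w = vec ?n (\<lambda>i. f (vs ! i))"
    have w: "w \<in> carrier_vec ?n" by (simp add: w_def)
    obtain i where i: "i < ?n" "v = vs ! i" using f(1) V by (metis in_set_conv_nth)
    have "w \<noteq> 0\<^sub>v ?n"
    proof
      assume "w = 0\<^sub>v ?n"
      then have "w $ i = 0" using i by simp
      then show False using i f(2) by (simp add: w_def)
    qed
    moreover have "?A *\<^sub>v w = x \<cdot>\<^sub>v w"
    proof (rule eq_vecI)
      fix i assume "i < dim_vec (x \<cdot>\<^sub>v w)"
      then have i: "i < ?n" by (simp add: w_def)
      have mem: "vs ! i \<in> sg_verts G" using V i nth_mem by blast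
      have wj: "w $ j = f (vs ! j)" if "j < ?n" for j using that by (simp add: w_def)
      have "(?A *\<^sub>v w) $ i = (\<Sum>j<?n. adj_entry G (vs ! i) (vs ! j) * f (vs ! j))"
        unfolding mult[OF w i] by (rule sum.cong) (simp_all add: wj)
      also have "\<dots> = x * f (vs ! i)"
        using f(3)[OF mem] unfolding sum_V .
      also have "\<dots> = (x \<cdot>\<^sub>v w) $ i" using i by (simp add: w_def)
      finally show "(?A *\<^sub>v w) $ i = (x \<cdot>\<^sub>v w) $ i" .
    qed (simp add: w_def adj_matrix_def)
    ultimately show "eigenvalue ?A x"
      using w carr unfolding eigenvalue_def eigenvector_def by (intro exI[of _ w]) simp
  qed
qed

lemma sg_eigenvalues_eq:
  assumes "distinct vs" and "set vs = sg_verts G"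
  shows "sg_eigenvalues G = {x. eigenvalue (adj_matrix G vs) x}"
proof -
  have "eigenvalue (adj_matrix G us) x = eigenvalue (adj_matrix G vs) x"
    if "distinct us" "set us = sg_verts G" for us x
    unfolding eigenvalue_adj_matrix_iff[OF that] eigenvalue_adj_matrix_iff[OF assms] ..
  then show ?thesis unfolding sg_eigenvalues_def using assms by blast
qed

end

theory Submission
  imports Defs "HOL-Analysis.Function_Topology"
begin

text \<open>
  Suppose the spectral radius \<open>r\<close> of \<open>G\<close> is at least that of \<open>C3neg_dot_K n\<close>, which exceeds
  \<open>n - 3\<close>. After switching and, if \<open>-r\<close> rather than \<open>r\<close> is an eigenvalue, negating all signs,
  \<open>r\<close> has an eigenfunction \<open>x\<close> with values in \<open>[0, 1]\<close> and maximum \<open>1\<close>. The eigenvalue equation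
  at the maximum gives \<open>\<Sum>(1 - x v) < 2\<close>, and every vertex \<open>u\<close> has at least \<open>(n - 3) x u\<close> positive
  neighbours. Hence at most two vertices are low (\<open>x < 1/3\<close>), at most seven fail \<open>x \<ge> 3/4\<close>, and
  any two vertices that are not low are joined by positive paths with any number of vertices from
  \<open>5\<close> to \<open>2 k + 1\<close>, avoiding two prescribed vertices.

  If the signs were negated, a cycle of \<open>2 k + 1\<close> positive edges is a negative cycle of \<open>G\<close>, a
  contradiction. Otherwise, closing positive paths to cycles of length \<open>2 k + 1\<close> shows that every
  negative edge meets a low vertex and that each low vertex sees the others with a single sign. As
  \<open>G\<close> is unbalanced, there are two low vertices \<open>a\<close>, \<open>b\<close>, which after switching are joined by a
  negative edge and have a single further neighbour, the same for both. So \<open>G\<close> is, up to switching,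
  a subgraph of \<open>C3neg_dot_K n\<close> that lacks only edges between vertices where \<open>x\<close> is positive, and
  comparing Rayleigh quotients shows that it lacks none.
\<close>

section \<open>Rayleigh quotients and the spectral radius\<close>

text \<open>Compactness of the unit sphere of the functions supported on \<open>V\<close>, followed
  by scaling.\<close>

lemma quadratic_form_maximum:
  fixes A :: "'a \<Rightarrow> 'a \<Rightarrow> real"
  assumes fin: "finite V" and ne: "V \<noteq> {}"
  obtains f where "(\<Sum>u\<in>V. (f u)\<^sup>2) = 1"
    and "\<And>g. (\<Sum>u\<in>V. \<Sum>v\<in>V. A u v * g u * g v)
      \<le> (\<Sum>u\<in>V. \<Sum>v\<in>V. A u v * f u * f v) * (\<Sum>u\<in>V. (g u)\<^sup>2)"
proof -
  define Q where "Q g = (\<Sum>u\<in>V. \<Sum>v\<in>V. A u v * g u * g v)" for g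
  define N where "N g = (\<Sum>u\<in>V. (g u)\<^sup>2)" for g :: "'a \<Rightarrow> real"
  \<comment> \<open>The type \<open>'a\<close> may be infinite, so functions are pinned to 0 outside
    \<open>V\<close>. Then \<open>S\<close> is a product of compact sets and Tychonoff
    applies.\<close>
  define S where "S = (\<Pi>\<^sub>E v\<in>UNIV. if v \<in> V then {-1..1} else {0::real})"
  have "compactin (product_topology (\<lambda>_. euclidean) UNIV) S"
    unfolding S_def by (subst compactin_PiE) auto
  then have "compact S" by (simp add: euclidean_product_topology)
  moreover have cont: "continuous_on UNIV N" "continuous_on UNIV Q"
    unfolding N_def Q_def by (intro continuous_intros continuous_on_product_coordinates)+
  have "closed {f. N f = 1}"
    using cont by (intro closed_Collect_eq) auto
  ultimately have comp: "compact (S \<inter> {f. N f = 1})" by (rule compact_Int_closed)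
  have inS: "(\<lambda>v. if v \<in> V then g v else 0) \<in> S" if "N g = 1" for g
  proof -
    have "\<bar>g v\<bar> \<le> 1" if "v \<in> V" for v
    proof -
      have "(g v)\<^sup>2 \<le> N g" unfolding N_def using fin that by (intro member_le_sum) auto
      then show ?thesis using \<open>N g = 1\<close> by (simp add: abs_square_le_1)
    qed
    then show ?thesis by (force simp: S_def abs_le_iff)
  qed
  have restr: "N (\<lambda>v. if v \<in> V then g v else 0) = N g"
    "Q (\<lambda>v. if v \<in> V then g v else 0) = Q g" for g
    unfolding N_def Q_def by (auto intro!: sum.cong)
  obtain w where w: "w \<in> V" using ne by blast
  have "N (\<lambda>v. if v = w then 1 else 0) = (\<Sum>u\<in>V. if u = w then 1 else 0)"
    unfolding N_def by (intro sum.cong) auto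
  then have "N (\<lambda>v. if v = w then 1 else 0) = 1" using fin w by simp
  from inS[OF this] restr(1)[of "\<lambda>v. if v = w then 1 else 0"] this
  have "S \<inter> {f. N f = 1} \<noteq> {}" by auto
  then obtain f where f: "f \<in> S" "N f = 1" "\<And>g. g \<in> S \<Longrightarrow> N g = 1 \<Longrightarrow> Q g \<le> Q f"
    using continuous_attains_sup[OF comp, of Q] continuous_on_subset[OF cont(2)] by blast
  have unit: "Q g \<le> Q f" if "N g = 1" for g
    using f(3)[OF inS[OF that]] restr[of g] that by simp
  have "Q g \<le> Q f * N g" for g
  proof (cases "N g = 0")
    case True
    then have "\<forall>u\<in>V. g u = 0"
      unfolding N_def using fin by (subst (asm) sum_nonneg_eq_0_iff) auto
    then show ?thesis unfolding Q_def using True by simp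
  next
    case False
    then have pos: "N g > 0" unfolding N_def by (simp add: sum_nonneg less_le)
    define c where "c = 1 / sqrt (N g)"
    have c2: "c\<^sup>2 = 1 / N g" using pos by (simp add: c_def power_divide)
    have "N (\<lambda>v. c * g v) = c\<^sup>2 * N g"
      unfolding N_def by (simp add: power_mult_distrib sum_distrib_left)
    moreover have "Q (\<lambda>v. c * g v) = c\<^sup>2 * Q g"
      unfolding Q_def by (simp add: sum_distrib_left power2_eq_square algebra_simps)
    ultimately have "Q g / N g \<le> Q f" using unit[of "\<lambda>v. c * g v"] pos c2 by simp
    then show ?thesis using pos by (simp add: divide_le_eq)
  qed
  then show thesis using that[of f] f(2) unfolding Q_def N_def by blast
qed

text \<open>First variation: perturbing a maximiser \<open>f\<close> of the Rayleigh quotient in the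
  direction of one coordinate \<open>w\<close> cannot increase the quotient, and the term linear in
  \<open>t\<close> must vanish. That term is the eigenvalue equation at \<open>w\<close>.\<close>

lemma symmetric_top_eigenvalue:
  fixes A :: "'a \<Rightarrow> 'a \<Rightarrow> real"
  assumes fin: "finite V" and ne: "V \<noteq> {}" and sym: "\<And>u v. A u v = A v u"
  obtains \<mu> f where "\<exists>v\<in>V. f v \<noteq> 0" and "\<And>u. u \<in> V \<Longrightarrow> (\<Sum>v\<in>V. A u v * f v) = \<mu> * f u"
    and "\<And>g. (\<Sum>u\<in>V. \<Sum>v\<in>V. A u v * g u * g v) \<le> \<mu> * (\<Sum>u\<in>V. (g u)\<^sup>2)"
proof -
  define Q where "Q g = (\<Sum>u\<in>V. \<Sum>v\<in>V. A u v * g u * g v)" for g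
  define N where "N g = (\<Sum>u\<in>V. (g u)\<^sup>2)" for g :: "'a \<Rightarrow> real"
  obtain f where N1: "N f = 1" and max: "\<And>g. Q g \<le> Q f * N g"
    by (rule quadratic_form_maximum[OF fin ne, of A, folded Q_def N_def]) blast
  have "(\<Sum>v\<in>V. A w v * f v) = Q f * f w" if w: "w \<in> V" for w
  proof -
    define d where "d = (\<Sum>v\<in>V. A w v * f v) - Q f * f w"
    define e where "e v = (if v = w then 1 else 0::real)" for v
    have "(\<Sum>u\<in>V. \<Sum>v\<in>V. A u v * e u * f v) = (\<Sum>u\<in>V. e u * (\<Sum>v\<in>V. A u v * f v))"
      by (simp add: sum_distrib_left mult_ac)
    also have "\<dots> = (\<Sum>v\<in>V. A w v * f v)" using fin w by (simp add: e_def if_distrib[of "\<lambda>x. x * _"] cong: if_cong)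
    finally have ef: "(\<Sum>u\<in>V. \<Sum>v\<in>V. A u v * e u * f v) = (\<Sum>v\<in>V. A w v * f v)" .
    have "(\<Sum>u\<in>V. \<Sum>v\<in>V. A u v * f u * e v) = (\<Sum>v\<in>V. \<Sum>u\<in>V. A u v * f u * e v)"
      by (rule sum.swap)
    also have "\<dots> = (\<Sum>u\<in>V. \<Sum>v\<in>V. A u v * e u * f v)"
      by (intro sum.cong refl) (simp add: sym mult_ac)
    finally have fe: "(\<Sum>u\<in>V. \<Sum>v\<in>V. A u v * f u * e v) = (\<Sum>v\<in>V. A w v * f v)" using ef by simp
    have Qt: "Q (\<lambda>v. f v + t * e v) = Q f + 2 * t * (\<Sum>v\<in>V. A w v * f v) + t\<^sup>2 * Q e" for t
    proof -
      have "Q (\<lambda>v. f v + t * e v) = (\<Sum>u\<in>V. \<Sum>v\<in>V. A u v * f u * f v + t * (A u v * f u * e v)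
          + t * (A u v * e u * f v) + t\<^sup>2 * (A u v * e u * e v))"
        unfolding Q_def by (intro sum.cong refl) (simp add: algebra_simps power2_eq_square)
      also have "\<dots> = Q f + t * (\<Sum>u\<in>V. \<Sum>v\<in>V. A u v * f u * e v)
          + t * (\<Sum>u\<in>V. \<Sum>v\<in>V. A u v * e u * f v) + t\<^sup>2 * Q e"
        unfolding Q_def by (simp only: sum.distrib sum_distrib_left)
      finally show ?thesis by (simp add: ef fe)
    qed
    have few: "(\<Sum>u\<in>V. f u * e u) = f w"
      using fin w by (simp add: e_def if_distrib[of "\<lambda>x. _ * x"] cong: if_cong)
    have Nt: "N (\<lambda>v. f v + t * e v) = N f + 2 * t * f w + t\<^sup>2 * N e" for t
    proof -
      have "N (\<lambda>v. f v + t * e v) = (\<Sum>u\<in>V. (f u)\<^sup>2 + 2 * t * (f u * e u) + t\<^sup>2 * (e u)\<^sup>2)"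
        unfolding N_def by (intro sum.cong refl) (simp add: algebra_simps power2_eq_square)
      also have "\<dots> = N f + 2 * t * (\<Sum>u\<in>V. f u * e u) + t\<^sup>2 * N e"
        unfolding N_def by (simp only: sum.distrib sum_distrib_left)
      finally show ?thesis by (simp add: few)
    qed
    \<comment> \<open>The summand 1 keeps \<open>c\<close> positive, so that
      \<open>t = d / c\<close> can be inserted below; it turns \<open>key\<close> into
      \<open>2 * d\<^sup>2 / c \<le> d\<^sup>2 / c\<close>.\<close>
    define c where "c = \<bar>Q f * N e - Q e\<bar> + 1"
    have c: "c > 0" "Q f * N e - Q e < c" by (auto simp: c_def)
    have key: "2 * t * d \<le> t\<^sup>2 * c" for t
    proof -
      have "2 * t * d \<le> t\<^sup>2 * (Q f * N e - Q e)"
        using max[of "\<lambda>v. f v + t * e v"] unfolding Qt Nt N1 d_def by (simp add: algebra_simps)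
      also have "\<dots> \<le> t\<^sup>2 * c" using c by (intro mult_left_mono) auto
      finally show ?thesis .
    qed
    have "d\<^sup>2 \<le> 0" using key[of "d / c"] c by (simp add: power2_eq_square field_simps)
    then show ?thesis by (simp add: d_def)
  qed
  moreover have "\<exists>v\<in>V. f v \<noteq> 0"
  proof (rule ccontr)
    assume "\<not> (\<exists>v\<in>V. f v \<noteq> 0)"
    then have "N f = 0" by (simp add: N_def)
    then show False using N1 by simp
  qed
  ultimately show thesis using that[of f "Q f"] max unfolding Q_def N_def by blast
qed

section \<open>Eigenvalues of signed graphs\<close>

lemma adj_entry_sym: "adj_entry G u v = adj_entry G v u"
  by (simp add: adj_entry_def insert_commute)

lemma adj_entry_values:
  assumes "signed_graph G"
  shows "adj_entry G u v \<in> {-1, 0, 1}"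
  using assms by (auto simp: adj_entry_def signed_graph_def)

lemma adj_entry_diag:
  assumes "signed_graph G"
  shows "adj_entry G u u = 0"
  using assms by (auto simp: adj_entry_def signed_graph_def)

lemma sg_eigenvalues_iff:
  assumes "finite (sg_verts G)"
  shows "\<mu> \<in> sg_eigenvalues G \<longleftrightarrow>
    (\<exists>f. (\<exists>v\<in>sg_verts G. f v \<noteq> 0) \<and>
         (\<forall>u\<in>sg_verts G. (\<Sum>v\<in>sg_verts G. adj_entry G u v * f v) = \<mu> * f u))"
proof -
  obtain vs where vs: "distinct vs" "set vs = sg_verts G"
    using finite_distinct_list[OF assms] by blast
  show ?thesis using sg_eigenvalues_eq[OF vs] eigenvalue_adj_matrix_iff[OF vs] by simp
qed

lemma finite_sg_eigenvalues:
  assumes "finite (sg_verts G)"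
  shows "finite (sg_eigenvalues G)"
proof -
  obtain vs where vs: "distinct vs" "set vs = sg_verts G"
    using finite_distinct_list[OF assms] by blast
  define m where "m = length vs"
  have carr: "adj_matrix G vs \<in> carrier_mat m m" by (simp add: adj_matrix_def m_def)
  have "sg_eigenvalues G = {x. poly (char_poly (adj_matrix G vs)) x = 0}"
    using eigenvalue_root_char_poly[OF carr] sg_eigenvalues_eq[OF vs] by auto
  moreover have "char_poly (adj_matrix G vs) \<noteq> 0"
    using degree_monic_char_poly[OF carr] by auto
  ultimately show ?thesis using poly_roots_finite by auto
qed

text \<open>The maximum of the Rayleigh quotient is itself an eigenvalue, hence at most the spectral
  radius.\<close>

lemma rayleigh_le_spectral_radius:
  assumes fin: "finite (sg_verts G)" and ne: "sg_verts G \<noteq> {}"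
  shows "(\<Sum>u\<in>sg_verts G. \<Sum>v\<in>sg_verts G. adj_entry G u v * g u * g v)
    \<le> sg_spectral_radius G * (\<Sum>u\<in>sg_verts G. (g u)\<^sup>2)"
proof -
  obtain \<mu> f where f: "\<exists>v\<in>sg_verts G. f v \<noteq> 0"
    "\<And>u. u \<in> sg_verts G \<Longrightarrow> (\<Sum>v\<in>sg_verts G. adj_entry G u v * f v) = \<mu> * f u"
    "\<And>g. (\<Sum>u\<in>sg_verts G. \<Sum>v\<in>sg_verts G. adj_entry G u v * g u * g v)
      \<le> \<mu> * (\<Sum>u\<in>sg_verts G. (g u)\<^sup>2)"
    by (rule symmetric_top_eigenvalue[OF fin ne, of "adj_entry G"]) (blast intro: adj_entry_sym)+
  have "\<mu> \<in> sg_eigenvalues G" using f sg_eigenvalues_iff[OF fin] by blast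
  then have "\<mu> \<le> sg_spectral_radius G"
    unfolding sg_spectral_radius_def using finite_sg_eigenvalues[OF fin] by (simp add: le_max_iff_disj)
  then show ?thesis using f(3)[of g] by (smt (verit) mult_right_mono sum_nonneg zero_le_power2)
qed

text \<open>The sign \<open>s\<close> records which end of the spectrum attains the radius. Absorbed
  into the matrix, it makes the radius an eigenvalue in both cases.\<close>

lemma spectral_radius_eigenfunction:
  assumes fin: "finite (sg_verts G)" and ne: "sg_verts G \<noteq> {}"
  obtains f and s :: real where "s = 1 \<or> s = -1" and "\<exists>v\<in>sg_verts G. f v \<noteq> 0"
    and "\<And>u. u \<in> sg_verts G \<Longrightarrow>
      (\<Sum>v\<in>sg_verts G. s * adj_entry G u v * f v) = sg_spectral_radius G * f u"
proof -
  \<comment> \<open>This only serves to show that the spectrum is nonempty, so that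
    \<open>Max\<close> and \<open>Min\<close> are members of it.\<close>
  obtain \<mu> f where f: "\<exists>v\<in>sg_verts G. f v \<noteq> 0"
    "\<And>u. u \<in> sg_verts G \<Longrightarrow> (\<Sum>v\<in>sg_verts G. adj_entry G u v * f v) = \<mu> * f u"
    by (rule symmetric_top_eigenvalue[OF fin ne, of "adj_entry G"]) (blast intro: adj_entry_sym)+
  then have nonempty: "sg_eigenvalues G \<noteq> {}" using sg_eigenvalues_iff[OF fin] by blast
  have "\<exists>s::real. (s = 1 \<or> s = -1) \<and> s * sg_spectral_radius G \<in> sg_eigenvalues G"
  proof (cases "- Min (sg_eigenvalues G) \<le> Max (sg_eigenvalues G)")
    case True
    then show ?thesis using Max_in[OF finite_sg_eigenvalues[OF fin] nonempty]
      by (intro exI[of _ 1]) (simp add: sg_spectral_radius_def)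
  next
    case False
    then show ?thesis using Min_in[OF finite_sg_eigenvalues[OF fin] nonempty]
      by (intro exI[of _ "-1"]) (simp add: sg_spectral_radius_def)
  qed
  then obtain s h where s: "s = 1 \<or> s = (-1::real)" "\<exists>v\<in>sg_verts G. h v \<noteq> 0"
    "\<And>u. u \<in> sg_verts G \<Longrightarrow>
       (\<Sum>v\<in>sg_verts G. adj_entry G u v * h v) = s * sg_spectral_radius G * h u"
    unfolding sg_eigenvalues_iff[OF fin] by blast
  have "(\<Sum>v\<in>sg_verts G. s * adj_entry G u v * h v) = sg_spectral_radius G * h u"
    if "u \<in> sg_verts G" for u
  proof -
    have "(\<Sum>v\<in>sg_verts G. s * adj_entry G u v * h v) = s * (\<Sum>v\<in>sg_verts G. adj_entry G u v * h v)"
      by (simp add: sum_distrib_left mult.assoc)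
    then show ?thesis using s that by auto
  qed
  then show thesis using that s by blast
qed

section \<open>Matrices with a large eigenvalue\<close>

text \<open>For entries in {-1, 0, 1}, the value -1 says at once that consecutive vertices are
  adjacent and that the signs multiply to -1.\<close>

definition closed_prod :: "('a \<Rightarrow> 'a \<Rightarrow> real) \<Rightarrow> 'a list \<Rightarrow> real" where
  "closed_prod A vs = (\<Prod>i<length vs. A (vs ! i) (vs ! (Suc i mod length vs)))"

fun walk_prod :: "('a \<Rightarrow> 'a \<Rightarrow> real) \<Rightarrow> 'a list \<Rightarrow> real" where
  "walk_prod A [] = 1"
| "walk_prod A [v] = 1"
| "walk_prod A (u # v # ws) = A u v * walk_prod A (v # ws)"

lemma walk_prod_eq_prod:
  "walk_prod A (u # ws) = (\<Prod>i<length ws. A ((u # ws) ! i) ((u # ws) ! Suc i))"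
proof (induction ws arbitrary: u)
  case (Cons v ws)
  show ?case using Cons[of v] by (simp add: prod.lessThan_Suc_shift del: prod.lessThan_Suc)
qed simp

lemma closed_prod_eq_walk_prod:
  assumes "p \<noteq> []"
  shows "closed_prod A p = walk_prod A p * A (last p) (hd p)"
proof -
  obtain u ws where p: "p = u # ws" using assms by (cases p) auto
  have "(\<Prod>i<length ws. A (p ! i) (p ! (Suc i mod length p))) = walk_prod A p"
    unfolding p walk_prod_eq_prod by (intro prod.cong) auto
  then show ?thesis by (simp add: closed_prod_def p last_conv_nth)
qed

lemma walk_prod_eq_1: "successively (\<lambda>u v. A u v = 1) p \<Longrightarrow> walk_prod A p = 1"
  by (induction A p rule: walk_prod.induct) auto

text \<open>Each factor \<open>t v\<close> occurs twice, once as the start and once as the end of a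
  step, because the cyclic shift permutes the indices.\<close>

lemma closed_prod_switch:
  fixes t :: "'a \<Rightarrow> real"
  assumes "\<And>v. t v = 1 \<or> t v = -1"
  shows "closed_prod (\<lambda>u v. t u * A u v * t v) vs = closed_prod A vs"
proof -
  let ?n = "length vs"
  have t2: "t v * t v = 1" for v using assms[of v] by auto
  have bij: "bij_betw (\<lambda>i. Suc i mod ?n) {..<?n} {..<?n}"
  proof (cases "?n = 0")
    case False
    have "inj_on (\<lambda>i. Suc i mod ?n) {..<?n}"
      by (auto simp: inj_on_def mod_Suc split: if_splits)
    moreover have "(\<lambda>i. Suc i mod ?n) ` {..<?n} \<subseteq> {..<?n}" using False by auto
    ultimately show ?thesis by (simp add: bij_betw_def endo_inj_surj)
  qed simp
  have "(\<Prod>i<?n. t (vs ! (Suc i mod ?n))) = (\<Prod>i<?n. t (vs ! i))"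
    using prod.reindex_bij_betw[OF bij, of "\<lambda>i. t (vs ! i)"] .
  then have "closed_prod (\<lambda>u v. t u * A u v * t v) vs
      = closed_prod A vs * ((\<Prod>i<?n. t (vs ! i)) * (\<Prod>i<?n. t (vs ! i)))"
    unfolding closed_prod_def by (simp add: prod.distrib mult_ac)
  also have "(\<Prod>i<?n. t (vs ! i)) * (\<Prod>i<?n. t (vs ! i)) = 1"
    by (simp add: prod.distrib[symmetric] t2)
  finally show ?thesis by simp
qed

text \<open>A matrix is used instead of a signed graph because the argument is applied after
  switching and possibly negating all signs. The function \<open>x\<close> will be the absolute
  value of an eigenfunction, scaled to maximum 1.\<close>

locale near_complete =
  fixes V :: "'a set" and A :: "'a \<Rightarrow> 'a \<Rightarrow> real" and x :: "'a \<Rightarrow> real"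
    and r :: real and k :: nat and z :: 'a
  assumes fin: "finite V"
    and entries: "A u v \<in> {-1, 0, 1}"
    and sym: "A u v = A v u"
    and diag: "A u u = 0"
    and k3: "3 \<le> k" and order_ge: "10 * k + 11 \<le> card V"
    and x_nonneg: "u \<in> V \<Longrightarrow> 0 \<le> x u"
    and x_le_1: "u \<in> V \<Longrightarrow> x u \<le> 1"
    and z: "z \<in> V" "x z = 1"
    and eig: "u \<in> V \<Longrightarrow> (\<Sum>v\<in>V. A u v * x v) = r * x u"
    and r_gt: "real (card V) - 3 < r"
begin

section \<open>Weights of vertices and positive degrees\<close>

definition pos_nbrs :: "'a \<Rightarrow> 'a set" where "pos_nbrs u = {v \<in> V. A u v = 1}"
text \<open>The deficits \<open>1 - x v\<close> sum to less than 2, which excludes three deficits of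
  2/3 and eight of 1/4. Outside \<open>low\<close> the positive degree is still about a third of the
  order; in \<open>hub\<close> it exceeds half of it, so that two members of \<open>hub\<close> have
  many common neighbours.\<close>

definition low :: "'a set" where "low = {v \<in> V. x v < 1/3}"
definition hub :: "'a set" where "hub = {v \<in> V. 3/4 \<le> x v}"

lemma card_ge: "41 \<le> card V" using order_ge k3 by linarith

lemma entry_le_1: "A u v \<le> 1" using entries[of u v] by auto

text \<open>The eigenvalue equation at a vertex \<open>z\<close> of maximal weight gives \<open>r \<le> (\<Sum>v\<in>V - {z}. x v)\<close>.\<close>

lemma deficit_sum: "(\<Sum>v\<in>V. 1 - x v) < 2"
proof -
  have "r = (\<Sum>v\<in>V. A z v * x v)" using eig[OF z(1)] z(2) by simp
  also have "\<dots> = (\<Sum>v\<in>V - {z}. A z v * x v)"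
    using fin z diag by (simp add: sum.remove)
  also have "\<dots> \<le> (\<Sum>v\<in>V - {z}. x v)"
    using mult_right_mono[OF entry_le_1 x_nonneg, of _ z] by (intro sum_mono) auto
  also have "\<dots> = (\<Sum>v\<in>V. x v) - 1" using fin z by (simp add: sum_diff1)
  finally show ?thesis using r_gt by (simp add: sum_subtractf)
qed

text \<open>Markov's inequality for the deficits.\<close>

lemma deficit_card:
  assumes "T \<subseteq> V" and "\<And>v. v \<in> T \<Longrightarrow> c \<le> 1 - x v"
  shows "real (card T) * c < 2"
proof -
  have "real (card T) * c \<le> (\<Sum>v\<in>T. 1 - x v)" using sum_mono[OF assms(2)] by simp
  also have "\<dots> \<le> (\<Sum>v\<in>V. 1 - x v)" using assms(1) fin x_le_1 by (intro sum_mono2) auto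
  finally show ?thesis using deficit_sum by simp
qed

lemma card_low: "card low \<le> 2"
proof (rule ccontr)
  assume "\<not> card low \<le> 2"
  moreover have "real (card low) * (2/3) < 2" by (rule deficit_card) (auto simp: low_def)
  ultimately show False by simp
qed

lemma card_not_hub: "card (V - hub) \<le> 7"
proof (rule ccontr)
  assume "\<not> card (V - hub) \<le> 7"
  moreover have "real (card (V - hub)) * (1/4) < 2" by (rule deficit_card) (auto simp: hub_def)
  ultimately show False by simp
qed

lemma hub_subset: "hub \<subseteq> V - low" by (auto simp: hub_def low_def)

text \<open>In the eigenvalue equation at \<open>u\<close>, a positive neighbour contributes at most
  1 and every other vertex at most 0.\<close>

lemma pos_degree:
  assumes "u \<in> V"
  shows "(real (card V) - 3) * x u \<le> card (pos_nbrs u)"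
proof -
  have "(real (card V) - 3) * x u \<le> r * x u" using r_gt x_nonneg[OF assms] by (intro mult_right_mono) auto
  also have "\<dots> = (\<Sum>v\<in>V. A u v * x v)" using eig[OF assms] by simp
  also have "\<dots> \<le> (\<Sum>v\<in>V. if A u v = 1 then 1 else 0)"
  proof (intro sum_mono)
    fix v assume v: "v \<in> V"
    show "A u v * x v \<le> (if A u v = 1 then 1 else 0)"
      using entries[of u v] x_nonneg[OF v] x_le_1[OF v] by auto
  qed
  also have "\<dots> = card (pos_nbrs u)" using fin by (simp add: pos_nbrs_def sum.If_cases Int_def)
  finally show ?thesis .
qed

lemma finite_pos_nbrs: "finite (pos_nbrs u)" using fin by (simp add: pos_nbrs_def)

text \<open>The order is at least 41, so there are at least 38/3, hence 13, positive neighbours, and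
  at most seven of them lie outside \<open>hub\<close>.\<close>

lemma hub_nbrs:
  assumes "u \<in> V - low"
  shows "6 \<le> card (pos_nbrs u \<inter> hub)"
proof -
  have "real (card V) - 3 \<ge> 38" using card_ge by simp
  moreover have "x u \<ge> 1/3" using assms by (auto simp: low_def)
  ultimately have "38 * (1/3) \<le> (real (card V) - 3) * x u" by (intro mult_mono) auto
  then have "13 \<le> card (pos_nbrs u)" using pos_degree[of u] assms by simp
  moreover have "card (pos_nbrs u) \<le> card (pos_nbrs u \<inter> hub) + card (V - hub)"
    using finite_pos_nbrs fin
    by (intro order_trans[OF card_mono card_Un_le]) (auto simp: pos_nbrs_def)
  ultimately show ?thesis using card_not_hub by linarith
qed

section \<open>Positive paths and cycles of prescribed length\<close>

lemma hub_nbr_avoiding: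
  assumes "u \<in> V - low" and "finite X" and "card X \<le> 5"
  obtains p where "p \<in> hub" "A u p = 1" "p \<notin> X"
proof -
  have "\<not> pos_nbrs u \<inter> hub \<subseteq> X"
    using hub_nbrs[OF assms(1)] card_mono[OF assms(2), of "pos_nbrs u \<inter> hub"] assms(3) by linarith
  then show thesis using that by (auto simp: pos_nbrs_def)
qed

text \<open>Inclusion-exclusion: two degrees of at least 3/4 of \<open>card V - 3\<close> overlap in
  at least \<open>card V / 2 - 9/2\<close> vertices, of which at most seven lie outside
  \<open>hub\<close>. Since \<open>card V\<close> is at least \<open>10 * k + 11\<close>, at least
  \<open>5 * k - 6\<close> remain, and this reaches \<open>2 * k + 3\<close> precisely when
  \<open>k\<close> is at least 3.\<close>

lemma common_hub_nbr_avoiding: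
  assumes "p \<in> hub" and "q \<in> hub" and "finite X" and "card X \<le> 2 * k + 2"
  obtains w where "w \<in> hub" "A p w = 1" "A q w = 1" "w \<notin> X"
proof -
  let ?N = "pos_nbrs p \<inter> pos_nbrs q"
  have deg: "(real (card V) - 3) * (3/4) \<le> card (pos_nbrs u)" if "u \<in> hub" for u
  proof -
    have "(real (card V) - 3) * (3/4) \<le> (real (card V) - 3) * x u"
      using that card_ge by (intro mult_left_mono) (auto simp: hub_def)
    then show ?thesis using pos_degree[of u] that by (auto simp: hub_def)
  qed
  have "card (pos_nbrs p) + card (pos_nbrs q) = card (pos_nbrs p \<union> pos_nbrs q) + card ?N"
    using finite_pos_nbrs by (intro card_Un_Int)
  moreover have "card (pos_nbrs p \<union> pos_nbrs q) \<le> card V"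
    using fin by (intro card_mono) (auto simp: pos_nbrs_def)
  moreover have "card ?N \<le> card (?N \<inter> hub) + card (V - hub)"
    using finite_pos_nbrs fin
    by (intro order_trans[OF card_mono card_Un_le]) (auto simp: pos_nbrs_def)
  ultimately have "card (pos_nbrs p) + card (pos_nbrs q) \<le> card V + card (?N \<inter> hub) + 7"
    using card_not_hub by linarith
  then have "real (card (pos_nbrs p)) + real (card (pos_nbrs q)) \<le> real (card V) + real (card (?N \<inter> hub)) + 7"
    by linarith
  then have "real (card V) / 2 - 23/2 \<le> real (card (?N \<inter> hub))"
    using deg[OF assms(1)] deg[OF assms(2)] by argo
  moreover have "real (card V) \<ge> 10 * real k + 11" using order_ge by linarith
  ultimately have "2 * k + 3 \<le> card (?N \<inter> hub)" using k3 by linarith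
  then have "\<not> ?N \<inter> hub \<subseteq> X"
    using card_mono[OF assms(3), of "?N \<inter> hub"] assms(4) by linarith
  then show thesis using that by (auto simp: pos_nbrs_def)
qed

text \<open>The path grows from \<open>p\<close>: each new vertex only has to be a neighbour of its
  predecessor, and the last inner vertex is a common neighbour with \<open>q\<close>. Vertices
  already passed move into \<open>F\<close>, so \<open>card F + m\<close> never increases.\<close>

lemma hub_path:
  assumes "p \<in> hub" and "q \<in> hub" and "p \<noteq> q" and "finite F" and "1 \<le> m"
    and "card F + m \<le> 2 * k + 1"
  shows "\<exists>ps. length ps = m \<and> distinct (p # ps @ [q]) \<and> set ps \<subseteq> hub - F \<and>
    successively (\<lambda>u v. A u v = 1) (p # ps @ [q])"
  using assms(5,1,3,4,6)
proof (induction m arbitrary: p F rule: nat_induct_at_least)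
  case base
  have "card (insert p (insert q F)) \<le> 2 * k + 2"
    using base by (intro order_trans[OF card_insert_le_m1]) (auto simp: card_insert_if)
  then obtain w where "w \<in> hub" "A p w = 1" "A q w = 1" "w \<notin> insert p (insert q F)"
    using common_hub_nbr_avoiding[OF base(1) assms(2), of "insert p (insert q F)"] base by blast
  then show ?case using base by (intro exI[of _ "[w]"]) (auto simp: sym[of w q])
next
  case (Suc m)
  have "card (insert p (insert q F)) \<le> 2 * k + 2"
    using Suc.prems by (auto simp: card_insert_if)
  \<comment> \<open>Using \<open>p\<close> for both vertices yields just a neighbour of
    \<open>p\<close> in \<open>hub\<close>.\<close>
  then obtain w where w: "w \<in> hub" "A p w = 1" "w \<notin> insert p (insert q F)"
    using common_hub_nbr_avoiding[OF \<open>p \<in> hub\<close> \<open>p \<in> hub\<close>, of "insert p (insert q F)"] Suc.prems by blast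
  have "card (insert p F) + m \<le> 2 * k + 1" using Suc.prems by (auto simp: card_insert_if)
  then obtain ps where "length ps = m" "distinct (w # ps @ [q])" "set ps \<subseteq> hub - insert p F"
    "successively (\<lambda>u v. A u v = 1) (w # ps @ [q])"
    using Suc.IH[of w "insert p F"] w Suc.prems(3) by blast
  then show ?case using w Suc.prems(2) by (intro exI[of _ "w # ps"]) auto
qed

text \<open>The ends need not lie in \<open>hub\<close>, so each first steps to a neighbour
  \<open>p\<close> or \<open>q\<close> there. These four vertices and at least one inner vertex
  explain the lower bound 5 on the number \<open>l\<close> of vertices. The set \<open>F\<close>
  reserves the low vertices through which paths are closed later.\<close>

lemma positive_path:
  assumes u: "u \<in> V - low - F" and v: "v \<in> V - low - F" and uv: "u \<noteq> v"
    and F: "finite F" "card F \<le> 2" and l: "5 \<le> l" "l \<le> 2 * k + 1"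
  obtains P where "length P = l" "hd P = u" "last P = v" "distinct P" "set P \<subseteq> V - F"
    "successively (\<lambda>u v. A u v = 1) P"
proof -
  have "card (insert v F) \<le> 5" using F by (auto simp: card_insert_if)
  then obtain p where p: "p \<in> hub" "A u p = 1" "p \<notin> insert v F"
    using hub_nbr_avoiding[of u "insert v F"] u F by blast
  have "card (insert u (insert p F)) \<le> 5" using F by (auto simp: card_insert_if)
  then obtain q where q: "q \<in> hub" "A v q = 1" "q \<notin> insert u (insert p F)"
    using hub_nbr_avoiding[of v "insert u (insert p F)"] v F by blast
  have "p \<noteq> u" "q \<noteq> v" using p q diag by auto
  have "1 \<le> l - 4" using l by simp
  have "card (insert u (insert v F)) + (l - 4) \<le> 2 * k + 1"
    using F l by (auto simp: card_insert_if)
  then obtain ps where ps: "length ps = l - 4" "distinct (p # ps @ [q])"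
    "set ps \<subseteq> hub - insert u (insert v F)" "successively (\<lambda>u v. A u v = 1) (p # ps @ [q])"
    using hub_path[OF p(1) q(1), of "insert u (insert v F)" "l - 4"] F \<open>1 \<le> l - 4\<close> q by blast
  have "successively (\<lambda>u v. A u v = 1) ((p # ps @ [q]) @ [v])"
    unfolding successively_append_iff using ps(4) q by (auto simp: sym[of q v])
  then have "successively (\<lambda>u v. A u v = 1) (u # p # ps @ [q, v])" using p by simp
  moreover have "set (u # p # ps @ [q, v]) \<subseteq> V - F"
    using u v p q ps(3) hub_subset by auto
  moreover have "distinct (u # p # ps @ [q, v])"
    using uv p q ps \<open>p \<noteq> u\<close> \<open>q \<noteq> v\<close> by auto
  moreover have "length (u # p # ps @ [q, v]) = l" using ps(1) l by simp
  ultimately show thesis using that[of "u # p # ps @ [q, v]"] by simp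
qed

text \<open>A path with \<open>2 * k + 1\<close> vertices from \<open>z\<close> to one of its
  positive neighbours is closed by the edge between them.\<close>

lemma positive_cycle:
  obtains vs where "length vs = 2 * k + 1" "distinct vs" "set vs \<subseteq> V" "closed_prod A vs = 1"
proof -
  have zl: "z \<in> V - low" using z by (auto simp: low_def)
  obtain v where v: "v \<in> hub" "A z v = 1" using hub_nbr_avoiding[OF zl, of "{}"] by auto
  then have "v \<in> V - low" "z \<noteq> v" using hub_subset diag by auto
  then obtain P where P: "length P = 2 * k + 1" "hd P = z" "last P = v" "distinct P"
      "set P \<subseteq> V - {}" "successively (\<lambda>u v. A u v = 1) P"
    using positive_path[of z "{}" v "2 * k + 1"] zl k3 by auto
  then have "P \<noteq> []" by auto
  with P have "closed_prod A P = 1"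
    using closed_prod_eq_walk_prod[of P A] walk_prod_eq_1[OF P(6)] v sym[of v z] by auto
  then show thesis using that P by auto
qed

text \<open>Positive paths are closed to cycles of length \<open>2 * k + 1\<close> through zero, one
  or two low vertices, and each time \<open>free\<close> excludes a sign pattern. The hypothesis
  \<open>unbal\<close> is used for the resulting switching \<open>t\<close> and for \<open>t\<close>
  flipped at a single low vertex.\<close>

lemma negative_structure:
  assumes free: "\<And>vs. length vs = 2 * k + 1 \<Longrightarrow> distinct vs \<Longrightarrow> set vs \<subseteq> V \<Longrightarrow>
      closed_prod A vs \<noteq> -1"
    and unbal: "\<And>t::'a \<Rightarrow> real. (\<And>v. t v = 1 \<or> t v = -1) \<Longrightarrow>
      \<exists>u\<in>V. \<exists>v\<in>V. t u * A u v * t v < 0"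
  obtains t :: "'a \<Rightarrow> real" and a b w where
    "\<And>v. t v = 1 \<or> t v = -1" "a \<in> V" "b \<in> V" "w \<in> V" "a \<noteq> b" "w \<noteq> a" "w \<noteq> b"
    "\<And>v. v \<in> V - {a, b} \<Longrightarrow> t v = 1 \<and> 0 < x v"
    "t a * A a b * t b = -1" "t a * A a w * t w = 1" "t b * A b w * t w = 1"
    "\<And>v. v \<in> V - {a, b, w} \<Longrightarrow> A a v = 0 \<and> A b v = 0"
proof -
  have lowV: "low \<subseteq> V" by (auto simp: low_def)
  have fin_low: "finite low" using lowV fin by (rule finite_subset)
  \<comment> \<open>Paths with \<open>2 * k + 1\<close>, \<open>2 * k\<close> and
    \<open>2 * k - 1\<close> vertices are needed; the shortest is long enough because
    \<open>k\<close> is at least 3.\<close>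
  have k: "5 \<le> 2 * k + 1" "5 \<le> 2 * k" "5 \<le> 2 * k - 1" "2 * k - 1 \<le> 2 * k + 1" using k3 by auto
  have nonneg_iff: "0 \<le> A u v \<longleftrightarrow> A u v \<noteq> -1" for u v using entries[of u v] by auto
  \<comment> \<open>A negative edge between vertices that are not low would close a positive path
    with all \<open>2 * k + 1\<close> vertices.\<close>
  have outside: "A u v \<noteq> -1" if uv: "u \<in> V - low" "v \<in> V - low" for u v
  proof
    assume neg: "A u v = -1"
    then have "u \<noteq> v" using diag by auto
    then obtain P where P: "length P = 2 * k + 1" "hd P = u" "last P = v" "distinct P"
        "set P \<subseteq> V - {}" "successively (\<lambda>u v. A u v = 1) P"
      using positive_path[of u "{}" v "2 * k + 1"] uv k by auto
    then have "P \<noteq> []" by auto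
    with P have "closed_prod A P = -1"
      using closed_prod_eq_walk_prod[of P A] walk_prod_eq_1[OF P(6)] neg sym[of v u] by auto
    then show False using free P by auto
  qed
  \<comment> \<open>The low vertex \<open>a\<close>, with one positive and one negative edge, would
    close a path with \<open>2 * k\<close> vertices that avoids \<open>low\<close>.\<close>
  have same_sign: False
    if a: "a \<in> low" and uv: "u \<in> V - low" "v \<in> V - low" and au: "A a u = 1" and av: "A a v = -1"
    for a u v
  proof -
    have "u \<noteq> v" using au av by auto
    then obtain P where P: "length P = 2 * k" "hd P = u" "last P = v" "distinct P"
        "set P \<subseteq> V - low" "successively (\<lambda>u v. A u v = 1) P"
      using positive_path[of u low v "2 * k"] uv k fin_low card_low by auto
    then obtain ps where ps: "P = u # ps" using k by (cases P) auto
    have "closed_prod A (a # P) = -1"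
      using closed_prod_eq_walk_prod[of "a # P" A] walk_prod_eq_1[OF P(6)] P(3) au av sym[of v a]
      by (auto simp: ps)
    moreover have "length (a # P) = 2 * k + 1" "distinct (a # P)" "set (a # P) \<subseteq> V"
      using P a lowV by auto
    ultimately show False using free by blast
  qed
  \<comment> \<open>Low vertices whose edges to the rest are negative get switched. By
    \<open>same_sign\<close>, negative entries can then only remain between two low
    vertices.\<close>
  define t where "t v = (if v \<in> low \<and> (\<exists>u\<in>V - low. A v u = -1) then -1 else 1::real)" for v
  have t: "t v = 1 \<or> t v = -1" for v by (simp add: t_def)
  have t_out: "t v = 1" if "v \<notin> low" for v using that by (simp add: t_def)
  have B_low_out: "0 \<le> t a * A a v" if "a \<in> low" "v \<in> V - low" for a v
    using same_sign[of a v] that entries[of a v] by (auto simp: t_def)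
  have B_nonneg: "0 \<le> t u * A u v * t v" if uv: "u \<in> V" "v \<in> V" "u \<notin> low \<or> v \<notin> low" for u v
  proof (cases "u \<in> low")
    case True
    then show ?thesis using uv B_low_out[of u v] t_out[of v] by auto
  next
    case False
    show ?thesis
    proof (cases "v \<in> low")
      case True
      then show ?thesis using uv False B_low_out[of v u] t_out[of u] sym[of v u] by (auto simp: mult_ac)
    next
      case v: False
      then show ?thesis using uv False outside[of u v] nonneg_iff[of u v] t_out by auto
    qed
  qed
  obtain a b where ab: "a \<in> V" "b \<in> V" "t a * A a b * t b < 0" using unbal[of t] t by blast
  have ab_low: "a \<in> low" "b \<in> low" using B_nonneg[OF ab(1,2)] ab(3) by linarith+
  have "a \<noteq> b" using ab(3) diag by auto
  have low: "low = {a, b}"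
    using card_seteq[OF fin_low, of "{a, b}"] ab_low card_low \<open>a \<noteq> b\<close> by simp
  have B_ab: "t a * A a b * t b = -1"
    using ab(3) t[of a] t[of b] entries[of a b] by auto
  \<comment> \<open>Flipping the sign at \<open>c\<close> makes the edge between \<open>c\<close>
    and \<open>d\<close> positive. The negative entry that must still exist then joins
    \<open>c\<close> to a third vertex, and before the flip it was positive.\<close>
  have attached: "\<exists>p\<in>V - low. t c * A c p = 1" if c: "c \<in> low" "d \<in> low" "c \<noteq> d" for c d
  proof -
    have low': "low = {c, d}" using c low by auto
    have Bcd: "t c * A c d * t d = -1" "t d * A d c * t c = -1"
      using B_ab c low sym[of a b] by (auto simp: mult_ac)
    define t' where "t' v = (if v = c then - t v else t v)" for v
    have "t' v = 1 \<or> t' v = -1" for v using t[of v] by (auto simp: t'_def)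
    then have "\<exists>u\<in>V. \<exists>v\<in>V. t' u * A u v * t' v < 0" using unbal[of t'] by blast
    then obtain u v where uv: "u \<in> V" "v \<in> V" "t' u * A u v * t' v < 0" by blast
    have "\<exists>p. p \<in> V \<and> p \<noteq> c \<and> t' c * A c p * t' p < 0"
    proof (cases "u = c")
      case True
      then show ?thesis using uv diag by auto
    next
      case False
      have "v = c"
      proof (rule ccontr)
        assume "v \<noteq> c"
        then have "t u * A u v * t v < 0" using uv(3) False by (simp add: t'_def)
        then have "u \<in> low" "v \<in> low" using B_nonneg[OF uv(1,2)] by linarith+
        then have "u = d" "v = d" using low' False \<open>v \<noteq> c\<close> by auto
        then show False using uv(3) diag by auto
      qed
      then show ?thesis using uv False by (intro exI[of _ u]) (simp add: sym[of u c] mult_ac)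
    qed
    then obtain p where p: "p \<in> V" "p \<noteq> c" "0 < t c * A c p * t p"
      by (auto simp: t'_def)
    then have "p \<noteq> d" using Bcd by auto
    then have "p \<in> V - low" using p low' by auto
    then show ?thesis using p t_out[of p] t[of c] entries[of c p] by (intro bexI[of _ p]) auto
  qed
  \<comment> \<open>For different \<open>p\<close> and \<open>q\<close>, the negative edge between
    \<open>a\<close> and \<open>b\<close> and a positive path with \<open>2 * k - 1\<close> vertices
    from \<open>q\<close> to \<open>p\<close> would form a negative cycle.\<close>
  have cross: "p = q" if pq: "p \<in> V - low" "q \<in> V - low" "t a * A a p = 1" "t b * A b q = 1" for p q
  proof (rule ccontr)
    assume "p \<noteq> q"
    then obtain P where P: "length P = 2 * k - 1" "hd P = q" "last P = p" "distinct P"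
        "set P \<subseteq> V - low" "successively (\<lambda>u v. A u v = 1) P"
      using positive_path[of q low p "2 * k - 1"] pq k fin_low card_low by auto
    then obtain ps where ps: "P = q # ps" using k by (cases P) auto
    have "closed_prod A (a # b # P) = A a b * A b q * A p a"
      using closed_prod_eq_walk_prod[of "a # b # P" A] walk_prod_eq_1[OF P(6)] P(3)
      by (auto simp: ps)
    also have "\<dots> = (t a * A a b * t b) * (t b * A b q) * (t a * A a p)"
      using t[of a] t[of b] sym[of p a] by auto
    also have "\<dots> = -1" by (simp only: B_ab pq)
    finally have "closed_prod A (a # b # P) = -1" .
    moreover have "length (a # b # P) = 2 * k + 1" "distinct (a # b # P)" "set (a # b # P) \<subseteq> V"
      using P ab \<open>a \<noteq> b\<close> low k by auto
    ultimately show False using free by blast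
  qed
  obtain w where w: "w \<in> V - low" "t a * A a w = 1" using attached[OF ab_low \<open>a \<noteq> b\<close>] by blast
  obtain q where q: "q \<in> V - low" "t b * A b q = 1"
    using attached[OF ab_low(2,1)] \<open>a \<noteq> b\<close> by blast
  have "q = w" using cross[OF w(1) q(1) w(2) q(2)] by simp
  have zero: "A a v = 0 \<and> A b v = 0" if v: "v \<in> V - {a, b, w}" for v
  proof -
    have v': "v \<in> V - low" using v low by auto
    have "t a * A a v \<noteq> 1" "t b * A b v \<noteq> 1"
      using cross[OF v' q(1) _ q(2)] cross[OF w(1) v' w(2)] v \<open>q = w\<close> by auto
    then show ?thesis
      using B_low_out[OF ab_low(1) v'] B_low_out[OF ab_low(2) v'] t[of a] t[of b]
        entries[of a v] entries[of b v] by auto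
  qed
  show thesis
  proof (rule that[of t a b w])
    show "t v = 1 \<or> t v = -1" for v by (rule t)
    show "t v = 1 \<and> 0 < x v" if "v \<in> V - {a, b}" for v
      using that low t_out[of v] by (force simp: low_def)
    show "t a * A a w * t w = 1" "t b * A b w * t w = 1"
      using w q \<open>q = w\<close> t_out[of w] by auto
  qed (use ab \<open>a \<noteq> b\<close> w low B_ab zero in auto)
qed

end

section \<open>Switching, balance and the extremal graph\<close>

lemma edgeE:
  assumes "signed_graph G" and "e \<in> sg_edges G"
  obtains u v where "e = {u, v}" "u \<noteq> v" "u \<in> sg_verts G" "v \<in> sg_verts G"
proof -
  have "card e = 2" "e \<subseteq> sg_verts G" using assms by (simp_all add: signed_graph_def)
  then show thesis using that by (auto simp: card_2_iff)
qed

lemma adj_entry_nonzero_iff: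
  assumes "signed_graph G"
  shows "adj_entry G u v \<noteq> 0 \<longleftrightarrow> {u, v} \<in> sg_edges G"
proof -
  have "{u, v} \<in> sg_edges G \<Longrightarrow> sg_sign G {u, v} = 1 \<or> sg_sign G {u, v} = -1"
    using assms by (simp add: signed_graph_def)
  then show ?thesis by (auto simp: adj_entry_def)
qed

lemma adj_entry_edge: "{u, v} \<in> sg_edges G \<Longrightarrow> adj_entry G u v = of_int (sg_sign G {u, v})"
  by (simp add: adj_entry_def)

lemma switch_simps [simp]:
  "sg_verts (switch U G) = sg_verts G" "sg_edges (switch U G) = sg_edges G"
  by (simp_all add: switch_def)

lemma sg_sign_switch:
  "sg_sign (switch U G) e =
    (if \<exists>u\<in>U. \<exists>v\<in>sg_verts G - U. e = {u, v} then - sg_sign G e else sg_sign G e)"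
  by (simp add: switch_def)

lemma signed_graph_switch: "signed_graph G \<Longrightarrow> signed_graph (switch U G)"
  unfolding signed_graph_def by (simp add: switch_def) force

lemma adj_entry_switch:
  assumes "u \<in> sg_verts G" and "v \<in> sg_verts G"
  shows "adj_entry (switch U G) u v =
    (if u \<in> U then -1 else 1) * adj_entry G u v * (if v \<in> U then -1 else 1)"
proof -
  have "(\<exists>u'\<in>U. \<exists>v'\<in>sg_verts G - U. {u, v} = {u', v'}) \<longleftrightarrow> (u \<in> U) \<noteq> (v \<in> U)"
    using assms by (auto simp: doubleton_eq_iff)
  then have "sg_sign (switch U G) {u, v} =
      (if (u \<in> U) \<noteq> (v \<in> U) then - sg_sign G {u, v} else sg_sign G {u, v})"
    by (simp only: sg_sign_switch)
  then show ?thesis by (simp add: adj_entry_def)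
qed

text \<open>An entry is nonzero exactly on edges and then equals the sign, so entries carry all the
  data of the graph.\<close>

lemma sg_isomorphicI:
  assumes G: "signed_graph G" and H: "signed_graph H" and bij: "bij_betw f (sg_verts G) (sg_verts H)"
    and adj: "\<And>u v. u \<in> sg_verts G \<Longrightarrow> v \<in> sg_verts G \<Longrightarrow>
      adj_entry H (f u) (f v) = adj_entry G u v"
  shows "sg_isomorphic G H"
proof -
  have iff: "{f u, f v} \<in> sg_edges H \<longleftrightarrow> {u, v} \<in> sg_edges G"
    if "u \<in> sg_verts G" "v \<in> sg_verts G" for u v
    using adj[OF that] adj_entry_nonzero_iff[OF G, of u v] adj_entry_nonzero_iff[OF H, of "f u" "f v"]
    by simp
  have "sg_edges H = (\<lambda>e. f ` e) ` sg_edges G"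
  proof (intro equalityI subsetI)
    fix e assume e: "e \<in> sg_edges H"
    then obtain i j where ij: "e = {i, j}" "i \<in> sg_verts H" "j \<in> sg_verts H" by (rule edgeE[OF H])
    then obtain u v where uv: "u \<in> sg_verts G" "v \<in> sg_verts G" "i = f u" "j = f v"
      using bij unfolding bij_betw_def by blast
    then have "{u, v} \<in> sg_edges G" "e = f ` {u, v}" using e ij iff by auto
    then show "e \<in> (\<lambda>e. f ` e) ` sg_edges G" by blast
  next
    fix e assume "e \<in> (\<lambda>e. f ` e) ` sg_edges G"
    then obtain d where d: "d \<in> sg_edges G" "e = f ` d" by blast
    obtain u v where "d = {u, v}" "u \<in> sg_verts G" "v \<in> sg_verts G"
      by (rule edgeE[OF G d(1)]) blast
    then show "e \<in> sg_edges H" using d iff by auto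
  qed
  moreover have "sg_sign H (f ` d) = sg_sign G d" if d: "d \<in> sg_edges G" for d
  proof -
    obtain u v where uv: "d = {u, v}" "u \<in> sg_verts G" "v \<in> sg_verts G"
      by (rule edgeE[OF G d]) blast
    have "{f u, f v} \<in> sg_edges H" using iff uv d by blast
    then have "(of_int (sg_sign H {f u, f v}) :: real) = of_int (sg_sign G {u, v})"
      using adj[OF uv(2,3)] adj_entry_edge[of "f u" "f v" H] adj_entry_edge[of u v G] d uv by simp
    then show ?thesis using uv by simp
  qed
  ultimately show ?thesis using bij unfolding sg_isomorphic_def by blast
qed

lemma sg_isomorphic_adj_entry:
  assumes G: "signed_graph G" and f: "bij_betw f (sg_verts G) (sg_verts H)"
    "sg_edges H = (\<lambda>e. f ` e) ` sg_edges G" "\<forall>e\<in>sg_edges G. sg_sign H (f ` e) = sg_sign G e"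
    and uv: "u \<in> sg_verts G" "v \<in> sg_verts G"
  shows "adj_entry H (f u) (f v) = adj_entry G u v"
proof -
  have inj: "inj_on f (sg_verts G)" using f(1) by (simp add: bij_betw_def)
  have "{f u, f v} \<in> sg_edges H \<longleftrightarrow> {u, v} \<in> sg_edges G"
  proof
    assume "{f u, f v} \<in> sg_edges H"
    then obtain d where d: "d \<in> sg_edges G" "f ` d = f ` {u, v}" using f(2) by auto
    moreover have "d \<subseteq> sg_verts G" using G d by (auto simp: signed_graph_def)
    ultimately have "d = {u, v}" using inj_on_image_eq_iff[OF inj, of d "{u, v}"] uv by auto
    then show "{u, v} \<in> sg_edges G" using d by simp
  next
    assume "{u, v} \<in> sg_edges G"
    then have "f ` {u, v} \<in> sg_edges H" unfolding f(2) by (rule imageI)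
    then show "{f u, f v} \<in> sg_edges H" by simp
  qed
  moreover have "sg_sign H {f u, f v} = sg_sign G {u, v}" if "{u, v} \<in> sg_edges G"
    using f(3) that by force
  ultimately show ?thesis by (simp add: adj_entry_def)
qed

text \<open>Switching conjugates the adjacency matrix by a diagonal matrix of signs and the
  isomorphism permutes it, so eigenfunctions are carried over by composing with \<open>f\<close> and
  multiplying by \<open>t\<close>.\<close>

lemma sg_spectral_radius_switching_equivalent:
  assumes G: "signed_graph G" and eq: "switching_equivalent G H"
  shows "sg_spectral_radius G = sg_spectral_radius H"
proof -
  obtain U f where U: "U \<subseteq> sg_verts G" and f: "bij_betw f (sg_verts G) (sg_verts H)"
    and f': "sg_edges H = (\<lambda>e. f ` e) ` sg_edges (switch U G)"
      "\<forall>e\<in>sg_edges (switch U G). sg_sign H (f ` e) = sg_sign (switch U G) e"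
    using eq unfolding switching_equivalent_def sg_isomorphic_def by auto
  define t where "t v = (if v \<in> U then -1 else 1::real)" for v
  have t2: "t v * t v = 1" for v by (simp add: t_def)
  have finG: "finite (sg_verts G)" using G by (simp add: signed_graph_def)
  then have finH: "finite (sg_verts H)" using f bij_betw_finite by blast
  have adj: "adj_entry H (f u) (f v) = t u * adj_entry G u v * t v"
    if "u \<in> sg_verts G" "v \<in> sg_verts G" for u v
    using sg_isomorphic_adj_entry[OF signed_graph_switch[OF G, of U] _ f', of u v] f that
      adj_entry_switch[OF that, of U] by (simp add: t_def)
  have sumH: "(\<Sum>v\<in>sg_verts H. adj_entry H (f u) v * h v)
      = t u * (\<Sum>v\<in>sg_verts G. adj_entry G u v * (t v * h (f v)))" if "u \<in> sg_verts G" for u h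
  proof -
    have "(\<Sum>v\<in>sg_verts H. adj_entry H (f u) v * h v)
        = (\<Sum>v\<in>sg_verts G. adj_entry H (f u) (f v) * h (f v))"
      using sum.reindex_bij_betw[OF f, of "\<lambda>v. adj_entry H (f u) v * h v"] by simp
    also have "\<dots> = (\<Sum>v\<in>sg_verts G. t u * (adj_entry G u v * (t v * h (f v))))"
      using that by (intro sum.cong refl) (simp add: adj mult_ac)
    finally show ?thesis by (simp add: sum_distrib_left)
  qed
  have imH: "sg_verts H = f ` sg_verts G" using f by (simp add: bij_betw_def)
  have "\<mu> \<in> sg_eigenvalues G \<longleftrightarrow> \<mu> \<in> sg_eigenvalues H" for \<mu>
  proof
    assume "\<mu> \<in> sg_eigenvalues H"
    then obtain h where h: "\<exists>v\<in>sg_verts H. h v \<noteq> 0"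
      "\<forall>u\<in>sg_verts H. (\<Sum>v\<in>sg_verts H. adj_entry H u v * h v) = \<mu> * h u"
      unfolding sg_eigenvalues_iff[OF finH] by blast
    have "(\<Sum>v\<in>sg_verts G. adj_entry G u v * (t v * h (f v))) = \<mu> * (t u * h (f u))"
      if u: "u \<in> sg_verts G" for u
    proof -
      have "t u * (\<Sum>v\<in>sg_verts G. adj_entry G u v * (t v * h (f v))) = \<mu> * h (f u)"
        using h(2) u imH sumH[OF u, of h] by auto
      then show ?thesis using t2[of u] by (auto simp: t_def split: if_splits)
    qed
    moreover have "\<exists>v\<in>sg_verts G. t v * h (f v) \<noteq> 0" using h(1) imH by (auto simp: t_def)
    ultimately show "\<mu> \<in> sg_eigenvalues G"
      unfolding sg_eigenvalues_iff[OF finG] by (intro exI[of _ "\<lambda>v. t v * h (f v)"]) blast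
  next
    assume "\<mu> \<in> sg_eigenvalues G"
    then obtain h where h: "\<exists>v\<in>sg_verts G. h v \<noteq> 0"
      "\<forall>u\<in>sg_verts G. (\<Sum>v\<in>sg_verts G. adj_entry G u v * h v) = \<mu> * h u"
      unfolding sg_eigenvalues_iff[OF finG] by blast
    define g where "g i = t (inv_into (sg_verts G) f i) * h (inv_into (sg_verts G) f i)" for i
    have g: "g (f v) = t v * h v" if "v \<in> sg_verts G" for v
      using that f by (simp add: g_def bij_betw_def inv_into_f_f)
    have "(\<Sum>j\<in>sg_verts H. adj_entry H (f u) j * g j) = \<mu> * g (f u)" if u: "u \<in> sg_verts G" for u
    proof -
      have "t v * g (f v) = h v" if "v \<in> sg_verts G" for v using g[OF that] by (simp add: t_def)
      then have "(\<Sum>v\<in>sg_verts G. adj_entry G u v * (t v * g (f v))) = (\<Sum>v\<in>sg_verts G. adj_entry G u v * h v)"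
        by (intro sum.cong refl) simp
      then show ?thesis using sumH[OF u, of g] h(2) u g[OF u] by (simp add: mult_ac)
    qed
    moreover have "\<exists>j\<in>sg_verts H. g j \<noteq> 0" using h(1) imH g by (auto simp: t_def)
    ultimately show "\<mu> \<in> sg_eigenvalues H"
      unfolding sg_eigenvalues_iff[OF finH] imH by blast
  qed
  then have "sg_eigenvalues G = sg_eigenvalues H" by blast
  then show ?thesis by (simp add: sg_spectral_radius_def)
qed

text \<open>The graph switched at the vertices with \<open>t v = -1\<close> is itself the required
  positive graph.\<close>

lemma balancedI:
  fixes t :: "'a \<Rightarrow> real"
  assumes G: "signed_graph G" and t: "\<And>v. t v = 1 \<or> t v = -1"
    and nonneg: "\<And>u v. u \<in> sg_verts G \<Longrightarrow> v \<in> sg_verts G \<Longrightarrow> 0 \<le> t u * adj_entry G u v * t v"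
  shows "balanced G"
proof -
  define U where "U = {v \<in> sg_verts G. t v = -1}"
  let ?H = "switch U G"
  have H: "signed_graph ?H" using G by (rule signed_graph_switch)
  have "sg_isomorphic ?H ?H" by (rule sg_isomorphicI[OF H H, of id]) auto
  then have "switching_equivalent G ?H" unfolding switching_equivalent_def by (intro exI[of _ U]) (simp add: U_def)
  moreover have "sg_sign ?H e = 1" if e: "e \<in> sg_edges ?H" for e
  proof -
    obtain u v where uv: "e = {u, v}" "u \<in> sg_verts G" "v \<in> sg_verts G"
      by (rule edgeE[OF H e]) simp
    have "adj_entry ?H u v = t u * adj_entry G u v * t v"
      using adj_entry_switch[OF uv(2,3), of U] uv t[of u] t[of v] by (auto simp: U_def)
    then have "0 \<le> (of_int (sg_sign ?H e) :: real)"
      using nonneg[OF uv(2,3)] adj_entry_edge[of u v ?H] e uv by simp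
    then show ?thesis using H e by (auto simp: signed_graph_def)
  qed
  ultimately show ?thesis using H unfolding balanced_def by blast
qed

text \<open>A nonzero product has no zero factor, so all consecutive vertices are adjacent and the
  list is a genuine cycle.\<close>

lemma negative_cycle_free_closed_prod:
  assumes G: "signed_graph G" and free: "negative_cycle_free (length vs) G"
    and vs: "3 \<le> length vs" "distinct vs" "set vs \<subseteq> sg_verts G"
  shows "closed_prod (adj_entry G) vs \<noteq> -1"
proof
  assume neg: "closed_prod (adj_entry G) vs = -1"
  have edge: "cycle_edge vs i \<in> sg_edges G" if "i < length vs" for i
  proof -
    have "closed_prod (adj_entry G) vs \<noteq> 0" using neg by simp
    then have "adj_entry G (vs ! i) (vs ! (Suc i mod length vs)) \<noteq> 0"
      using that unfolding closed_prod_def by simp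
    then show ?thesis unfolding cycle_edge_def by (simp add: adj_entry_nonzero_iff[OF G])
  qed
  then have "closed_prod (adj_entry G) vs = of_int (cycle_sign G vs)"
    unfolding closed_prod_def cycle_sign_def of_int_prod
    by (intro prod.cong refl) (simp add: adj_entry_def cycle_edge_def)
  then have "cycle_sign G vs = -1" using neg by linarith
  then show False using free vs edge unfolding negative_cycle_free_def is_cycle_def by blast
qed

section \<open>The extremal signed graph\<close>

lemma signed_graph_C3neg_dot_K:
  assumes "4 \<le> n"
  shows "signed_graph (C3neg_dot_K n)"
proof -
  have "e \<subseteq> {..<n} \<and> card e = 2" if e: "e \<in> sg_edges (C3neg_dot_K n)" for e
  proof -
    obtain u v where "e = {u, v}" "u < n" "v < n" "u \<noteq> v"
    proof -
      from e consider u v where "e = {u, v}" "u < n - 2" "v < n - 2" "u \<noteq> v"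
        | "e = {0, n - 2}" | "e = {0, n - 1}" | "e = {n - 2, n - 1}"
        unfolding C3neg_dot_K_def by auto
      then show thesis
      proof cases
        case (1 u v)
        then show thesis using that[of u v] by simp
      next
        case 2
        then show thesis using that[of 0 "n - 2"] assms by simp
      next
        case 3
        then show thesis using that[of 0 "n - 1"] assms by simp
      next
        case 4
        then show thesis using that[of "n - 2" "n - 1"] assms by simp
      qed
    qed
    then show ?thesis by simp
  qed
  moreover have "sg_sign (C3neg_dot_K n) e \<in> {1, -1}" for e by (simp add: C3neg_dot_K_def)
  ultimately show ?thesis unfolding signed_graph_def by (auto simp: C3neg_dot_K_def)
qed

lemma edge_C3neg_dot_K_iff:
  "{i, j} \<in> sg_edges (C3neg_dot_K n) \<longleftrightarrow> i < n - 2 \<and> j < n - 2 \<and> i \<noteq> j \<or>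
    {i, j} = {0, n - 2} \<or> {i, j} = {0, n - 1} \<or> {i, j} = {n - 2, n - 1}"
proof -
  have "{i, j} \<in> {{u, v} | u v. u < n - 2 \<and> v < n - 2 \<and> u \<noteq> v} \<longleftrightarrow>
      i < n - 2 \<and> j < n - 2 \<and> i \<noteq> j"
    by (auto simp: doubleton_eq_iff)
  then show ?thesis by (simp add: C3neg_dot_K_def disj_ac)
qed

lemma adj_entry_C3neg_dot_K:
  assumes n: "4 \<le> n"
  shows "i < n - 2 \<Longrightarrow> j < n - 2 \<Longrightarrow> i \<noteq> j \<Longrightarrow> adj_entry (C3neg_dot_K n) i j = 1"
    and "adj_entry (C3neg_dot_K n) (n - 2) (n - 1) = -1"
    and "adj_entry (C3neg_dot_K n) 0 (n - 2) = 1"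
    and "adj_entry (C3neg_dot_K n) 0 (n - 1) = 1"
    and "0 < i \<Longrightarrow> i < n - 2 \<Longrightarrow> adj_entry (C3neg_dot_K n) i (n - 2) = 0"
    and "0 < i \<Longrightarrow> i < n - 2 \<Longrightarrow> adj_entry (C3neg_dot_K n) i (n - 1) = 0"
proof -
  have sign: "sg_sign (C3neg_dot_K n) e = (if e = {n - 2, n - 1} then -1 else 1)" for e
    by (simp add: C3neg_dot_K_def)
  have neqs: "0 \<noteq> n - 2" "0 \<noteq> n - 1" "n - 2 \<noteq> n - 1" "\<not> n - 1 < n - 2" using n by linarith+
  note simps = adj_entry_def edge_C3neg_dot_K_iff sign doubleton_eq_iff
  show "i < n - 2 \<Longrightarrow> j < n - 2 \<Longrightarrow> i \<noteq> j \<Longrightarrow> adj_entry (C3neg_dot_K n) i j = 1"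
    by (simp add: simps)
  show "adj_entry (C3neg_dot_K n) (n - 2) (n - 1) = -1" by (simp add: simps)
  show "adj_entry (C3neg_dot_K n) 0 (n - 2) = 1" "adj_entry (C3neg_dot_K n) 0 (n - 1) = 1"
    using neqs by (simp_all add: simps)
  show "0 < i \<Longrightarrow> i < n - 2 \<Longrightarrow> adj_entry (C3neg_dot_K n) i (n - 2) = 0"
    "0 < i \<Longrightarrow> i < n - 2 \<Longrightarrow> adj_entry (C3neg_dot_K n) i (n - 1) = 0"
    using neqs by (auto simp: simps)
qed

text \<open>The complete part alone gives \<open>n - 3\<close>. A small weight on the two other
  vertices of the triangle improves the Rayleigh quotient, which yields the strict inequality that
  \<open>deficit_sum\<close> relies on.\<close>

lemma spectral_radius_C3neg_dot_K_gt:
  assumes n: "4 \<le> n"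
  shows "real n - 3 < sg_spectral_radius (C3neg_dot_K n)"
proof -
  let ?K = "C3neg_dot_K n"
  let ?a = "adj_entry ?K"
  obtain m where m: "n = Suc (Suc m)" "2 \<le> m" using that[of "n - 2"] n by simp
  have V: "sg_verts ?K = {..<n}" by (simp add: C3neg_dot_K_def)
  have diag: "?a i i = 0" for i using adj_entry_diag[OF signed_graph_C3neg_dot_K[OF n]] .
  have a: "?a m (Suc m) = -1" "?a (Suc m) m = -1"
    using adj_entry_C3neg_dot_K(2)[OF n] adj_entry_sym[of ?K m "Suc m"] by (simp_all add: m)
  have out: "?a i m = (if i = 0 then 1 else 0)" "?a i (Suc m) = (if i = 0 then 1 else 0)"
    "?a m i = (if i = 0 then 1 else 0)" "?a (Suc m) i = (if i = 0 then 1 else 0)" if "i < m" for i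
    using adj_entry_C3neg_dot_K(3,4)[OF n] adj_entry_C3neg_dot_K(5,6)[OF n, of i] that m
      adj_entry_sym[of ?K i m] adj_entry_sym[of ?K i "Suc m"] by auto
  have ins: "?a i j = (if i = j then 0 else 1)" if "i < m" "j < m" for i j
    using adj_entry_C3neg_dot_K(1)[OF n, of i j] that m diag by auto
  \<comment> \<open>A weight \<open>c\<close> on the last two vertices adds
    \<open>4 * c - 2 * c\<^sup>2\<close> to the form and \<open>2 * c\<^sup>2\<close> to the norm.
    Against the factor \<open>m - 1\<close> this is a gain for \<open>0 < c < 2 / m\<close>.\<close>
  define g where "g i = (if i < m then 1 else 1 / real m)" for i
  have sum_n: "(\<Sum>i<n. h i) = (\<Sum>i<m. h i) + h m + h (Suc m)" for h :: "nat \<Rightarrow> real"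
    by (simp add: m(1))
  have N: "(\<Sum>i<n. (g i)\<^sup>2) = real m + 2 * (1 / real m)\<^sup>2"
    by (simp add: sum_n g_def)
  have row: "(\<Sum>j<m. ?a i j) = real m - 1" if "i < m" for i
  proof -
    have "(\<Sum>j<m. ?a i j) = (\<Sum>j<m. 1 - (if i = j then 1 else 0))"
      using that by (intro sum.cong) (auto simp: ins)
    then show ?thesis using that by (simp add: sum_subtractf)
  qed
  have Q: "(\<Sum>i<n. \<Sum>j<n. ?a i j * g i * g j)
      = real m * (real m - 1) + 4 * (1 / real m) - 2 * (1 / real m)\<^sup>2"
  proof -
    have "(\<Sum>i<m. \<Sum>j<n. ?a i j * g i * g j) = (\<Sum>i<m. (real m - 1) + 2 * (if i = 0 then 1 / real m else 0))"
      using row by (intro sum.cong refl) (simp add: sum_n g_def out)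
    also have "\<dots> = real m * (real m - 1) + 2 * (1 / real m)"
      using m(2) by (simp add: sum.distrib sum_distrib_left[symmetric])
    finally have 1: "(\<Sum>i<m. \<Sum>j<n. ?a i j * g i * g j) = real m * (real m - 1) + 2 * (1 / real m)" .
    have 2: "(\<Sum>j<n. ?a i j * g i * g j) = 1 / real m - (1 / real m)\<^sup>2" if i: "i = m \<or> i = Suc m" for i
    proof -
      have "(\<Sum>j<m. ?a i j * g i * g j) = (\<Sum>j<m. if j = 0 then 1 / real m else 0)"
        using i by (intro sum.cong) (auto simp: out g_def)
      also have "\<dots> = 1 / real m" using m(2) by simp
      finally show ?thesis using i by (auto simp: sum_n a diag g_def power2_eq_square)
    qed
    have "(\<Sum>i<n. \<Sum>j<n. ?a i j * g i * g j) = (\<Sum>i<m. \<Sum>j<n. ?a i j * g i * g j)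
       + (\<Sum>j<n. ?a m j * g m * g j) + (\<Sum>j<n. ?a (Suc m) j * g (Suc m) * g j)"
      by (rule sum_n)
    then show ?thesis using 1 2[of m] 2[of "Suc m"] by simp
  qed
  have "finite (sg_verts ?K)" "sg_verts ?K \<noteq> {}" using n by (simp_all add: V lessThan_empty_iff)
  from rayleigh_le_spectral_radius[OF this, of g]
  have le: "real m * (real m - 1) + 4 * (1 / real m) - 2 * (1 / real m)\<^sup>2
      \<le> sg_spectral_radius ?K * (real m + 2 * (1 / real m)\<^sup>2)"
    unfolding V Q N .
  have "(real m - 1) * (real m + 2 * (1 / real m)\<^sup>2)
      = real m * (real m - 1) + 2 * (1 / real m) - 2 * (1 / real m)\<^sup>2"
    using m(2) by (simp add: field_simps power2_eq_square)
  also have "\<dots> < real m * (real m - 1) + 4 * (1 / real m) - 2 * (1 / real m)\<^sup>2"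
    using m(2) by (simp add: divide_strict_right_mono)
  finally have "(real m - 1) * (real m + 2 * (1 / real m)\<^sup>2)
      < sg_spectral_radius ?K * (real m + 2 * (1 / real m)\<^sup>2)" using le by linarith
  then have "real m - 1 < sg_spectral_radius ?K"
    by (rule mult_right_less_imp_less) simp
  then show ?thesis by (simp add: m(1))
qed

section \<open>The extremal bound\<close>

text \<open>This labels vertices as in \<open>C3neg_dot_K\<close>, with \<open>w\<close> in the role
  of the identified vertex.\<close>

lemma bij_betw_three_points:
  assumes fin: "finite V" and n: "card V = n" and abw: "{a, b, w} \<subseteq> V" "a \<noteq> b" "w \<noteq> a" "w \<noteq> b"
  obtains f where "bij_betw f V {..<n}" "f w = 0" "f a = n - 2" "f b = n - 1"
    "\<And>v. v \<in> V - {a, b, w} \<Longrightarrow> 0 < f v \<and> f v < n - 2"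
proof -
  have c3: "card {a, b, w} = 3" using abw by auto
  have n3: "3 \<le> n" using card_mono[OF fin abw(1)] c3 n by simp
  have "card (V - {a, b, w}) = card {1..<n - 2}"
    using card_Diff_subset[OF _ abw(1)] c3 n by simp
  then obtain h where h: "bij_betw h (V - {a, b, w}) {1..<n - 2}"
    using finite_same_card_bij[of "V - {a, b, w}" "{1..<n - 2}"] fin by auto
  define f where "f v = (if v = w then 0 else if v = a then n - 2 else if v = b then n - 1 else h v)" for v
  have "bij_betw f (V - {a, b, w}) {1..<n - 2}"
    using h by (subst bij_betw_cong[where g = h]) (auto simp: f_def)
  moreover have "bij_betw f {a, b, w} {n - 2, n - 1, 0}"
    using abw n3 by (auto simp: bij_betw_def f_def inj_on_def)
  ultimately have "bij_betw f ((V - {a, b, w}) \<union> {a, b, w}) ({1..<n - 2} \<union> {n - 2, n - 1, 0})"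
    using n3 by (intro bij_betw_combine) auto
  moreover have "(V - {a, b, w}) \<union> {a, b, w} = V" using abw by auto
  moreover have "{1..<n - 2} \<union> {n - 2, n - 1, 0} = {..<n}" using n3 by auto
  ultimately have "bij_betw f V {..<n}" by simp
  moreover have "0 < f v \<and> f v < n - 2" if "v \<in> V - {a, b, w}" for v
    using that bij_betw_apply[OF h that] by (auto simp: f_def)
  ultimately show thesis using that[of f] abw by (simp add: f_def)
qed

lemma quadratic_form_eigenfunction:
  fixes A :: "'a \<Rightarrow> 'a \<Rightarrow> real"
  assumes "\<And>u. u \<in> V \<Longrightarrow> (\<Sum>v\<in>V. A u v * x v) = r * x u"
  shows "(\<Sum>u\<in>V. \<Sum>v\<in>V. A u v * x u * x v) = r * (\<Sum>u\<in>V. (x u)\<^sup>2)"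
proof -
  have "(\<Sum>v\<in>V. A u v * x u * x v) = r * (x u)\<^sup>2" if "u \<in> V" for u
  proof -
    have "(\<Sum>v\<in>V. A u v * x u * x v) = x u * (\<Sum>v\<in>V. A u v * x v)"
      by (simp add: sum_distrib_left mult_ac)
    then show ?thesis using assms[OF that] by (simp add: power2_eq_square)
  qed
  then show ?thesis by (simp add: sum_distrib_left)
qed

text \<open>Assuming only the weak reverse inequality serves both the bound and the case of
  equality.\<close>

lemma switching_equivalent_if_large_radius:
  fixes G :: "'a sgraph"
  assumes G: "signed_graph G" and order: "sg_order G = n" and unbal: "\<not> balanced G"
    and k: "3 \<le> k" and kn: "10 * k + 11 \<le> n" and free: "negative_cycle_free (2 * k + 1) G"
    and large: "sg_spectral_radius (C3neg_dot_K n) \<le> sg_spectral_radius G"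
  shows "switching_equivalent G (C3neg_dot_K n)"
proof -
  define V where "V = sg_verts G"
  define A where "A = adj_entry G"
  define r where "r = sg_spectral_radius G"
  let ?K = "C3neg_dot_K n"
  have n4: "4 \<le> n" using k kn by linarith
  have fin: "finite V" using G by (simp add: V_def signed_graph_def)
  have cardV: "card V = n" using order by (simp add: V_def sg_order_def)
  have ne: "V \<noteq> {}" using cardV n4 by auto
  have r_gt: "real n - 3 < r" using spectral_radius_C3neg_dot_K_gt[OF n4] large by (simp add: r_def)
  obtain f s where s: "s = 1 \<or> s = (-1::real)" and f_ne: "\<exists>v\<in>V. f v \<noteq> 0"
    and f_eig: "\<And>u. u \<in> V \<Longrightarrow> (\<Sum>v\<in>V. s * A u v * f v) = r * f u"
    by (rule spectral_radius_eigenfunction[of G, folded V_def A_def r_def, OF fin ne]) blast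
  \<comment> \<open>Switching where \<open>f\<close> is negative turns the eigenfunction into its
    absolute value.\<close>
  define t where "t v = (if f v < 0 then -1 else 1::real)" for v
  have t: "t v = 1 \<or> t v = -1" for v by (simp add: t_def)
  have tf: "t v * f v = \<bar>f v\<bar>" "t v * \<bar>f v\<bar> = f v" for v by (auto simp: t_def)
  define M where "M = Max ((\<lambda>v. \<bar>f v\<bar>) ` V)"
  have M_ge: "\<bar>f v\<bar> \<le> M" if "v \<in> V" for v using fin that by (simp add: M_def)
  have "M \<in> (\<lambda>v. \<bar>f v\<bar>) ` V" unfolding M_def using fin ne by (intro Max_in) auto
  then obtain z where z: "z \<in> V" "\<bar>f z\<bar> = M" by auto
  have M_pos: "0 < M" using f_ne M_ge by force
  define x where "x v = \<bar>f v\<bar> / M" for v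
  define B where "B u v = t u * A u v * t v" for u v
  define S where "S u v = s * B u v" for u v
  have A_values: "A u v \<in> {-1, 0, 1}" for u v unfolding A_def by (rule adj_entry_values[OF G])
  have A_sym: "A u v = A v u" for u v unfolding A_def by (rule adj_entry_sym)
  have S_eig: "(\<Sum>v\<in>V. S u v * x v) = r * x u" if u: "u \<in> V" for u
  proof -
    have "(\<Sum>v\<in>V. S u v * x v) = (\<Sum>v\<in>V. t u / M * (s * A u v * (t v * \<bar>f v\<bar>)))"
      by (intro sum.cong) (simp_all add: S_def B_def x_def mult_ac)
    also have "\<dots> = t u / M * (\<Sum>v\<in>V. s * A u v * f v)"
      by (simp only: tf sum_distrib_left)
    also have "\<dots> = r * (t u * f u / M)" using f_eig[OF u] by simp
    finally show ?thesis by (simp add: tf x_def)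
  qed
  interpret near_complete V S x r k z
  proof
    show "S u v \<in> {-1, 0, 1}" for u v
      using A_values[of u v] s t[of u] t[of v] by (auto simp: S_def B_def)
    show "S u v = S v u" for u v using A_sym[of u v] by (simp add: S_def B_def mult_ac)
    show "S u u = 0" for u using adj_entry_diag[OF G, of u] by (simp add: S_def B_def A_def)
    show "x u \<le> 1" if "u \<in> V" for u using M_ge[OF that] M_pos by (simp add: x_def)
    show "x z = 1" using z M_pos by (simp add: x_def)
  qed (use fin k kn cardV z M_pos S_eig r_gt in \<open>auto simp: x_def\<close>)
  have B_prod: "closed_prod B vs \<noteq> -1" if "length vs = 2 * k + 1" "distinct vs" "set vs \<subseteq> V" for vs
  proof -
    have "closed_prod B vs = closed_prod A vs"
      unfolding B_def by (rule closed_prod_switch) (rule t)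
    then show ?thesis
      using negative_cycle_free_closed_prod[OF G, of vs] that free k by (simp add: A_def V_def)
  qed
  \<comment> \<open>Otherwise \<open>S\<close> is the negated matrix, and a positive cycle of odd
    length in \<open>S\<close> is negative in \<open>B\<close>.\<close>
  have "s = 1"
  proof (rule ccontr)
    assume "s \<noteq> 1"
    then have S_neg: "S = (\<lambda>u v. - 1 * B u v)" using s by (auto simp: S_def fun_eq_iff)
    obtain vs where vs: "length vs = 2 * k + 1" "distinct vs" "set vs \<subseteq> V" "closed_prod S vs = 1"
      by (rule positive_cycle)
    have "closed_prod S vs = (-1) ^ (2 * k + 1) * closed_prod B vs"
      unfolding S_neg closed_prod_def prod.distrib by (simp add: vs(1))
    then show False using vs B_prod[OF vs(1-3)] by simp
  qed
  then have SB: "S = B" by (simp add: S_def fun_eq_iff)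
  have unbal_B: "\<exists>u\<in>V. \<exists>v\<in>V. t' u * S u v * t' v < 0" if t': "\<And>v. t' v = 1 \<or> t' v = (-1::real)" for t'
  proof (rule ccontr)
    assume "\<not> ?thesis"
    then have nn: "0 \<le> t' u * S u v * t' v" if "u \<in> V" "v \<in> V" for u v using that by force
    have "balanced G"
    proof (rule balancedI[OF G, of "\<lambda>v. t' v * t v"])
      show "t' v * t v = 1 \<or> t' v * t v = -1" for v using t[of v] t'[of v] by auto
      show "0 \<le> t' u * t u * adj_entry G u v * (t' v * t v)" if "u \<in> sg_verts G" "v \<in> sg_verts G" for u v
        using nn[of u v] that by (simp add: SB B_def A_def V_def mult_ac)
    qed
    then show False using unbal by simp
  qed
  obtain t' :: "'a \<Rightarrow> real" and a b w where t': "\<And>v. t' v = 1 \<or> t' v = -1"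
    and abw: "a \<in> V" "b \<in> V" "w \<in> V" "a \<noteq> b" "w \<noteq> a" "w \<noteq> b"
    and t'_out: "\<And>v. v \<in> V - {a, b} \<Longrightarrow> t' v = 1 \<and> 0 < x v"
    and S_ab: "t' a * S a b * t' b = -1" "t' a * S a w * t' w = 1" "t' b * S b w * t' w = 1"
    and S_zero: "\<And>v. v \<in> V - {a, b, w} \<Longrightarrow> S a v = 0 \<and> S b v = 0"
    by (rule negative_structure) (use B_prod unbal_B in \<open>auto simp: SB\<close>)
  obtain g where g: "bij_betw g V {..<n}" "g w = 0" "g a = n - 2" "g b = n - 1"
    "\<And>v. v \<in> V - {a, b, w} \<Longrightarrow> 0 < g v \<and> g v < n - 2"
    by (rule bij_betw_three_points[OF fin cardV, of a b w]) (use abw in auto)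
  \<comment> \<open>\<open>C\<close> is the extremal graph carried over to \<open>V\<close>,
    \<open>D\<close> the switched matrix of \<open>G\<close>. They agree in the rows and columns of
    \<open>a\<close> and \<open>b\<close>; elsewhere off the diagonal \<open>C\<close> has the
    largest possible entry.\<close>
  define C where "C u v = adj_entry ?K (g u) (g v)" for u v
  define D where "D u v = t' u * S u v * t' v" for u v
  have C_sym: "C u v = C v u" for u v unfolding C_def by (rule adj_entry_sym)
  have D_sym: "D u v = D v u" for u v by (simp add: D_def sym[of u v])
  have C_diag: "C u u = 0" for u
    unfolding C_def by (rule adj_entry_diag[OF signed_graph_C3neg_dot_K[OF n4]])
  have CD_a: "C a v = D a v" if v: "v \<in> V" for v
  proof -
    consider "v = a" | "v = b" | "v = w" | "v \<in> V - {a, b, w}" using v by blast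
    then show ?thesis
    proof cases
      case 1
      then show ?thesis using C_diag diag by (simp add: D_def)
    next
      case 2
      then show ?thesis using adj_entry_C3neg_dot_K(2)[OF n4] S_ab by (simp add: C_def D_def g)
    next
      case 3
      then show ?thesis
        using adj_entry_C3neg_dot_K(3)[OF n4] S_ab adj_entry_sym[of ?K 0 "n - 2"]
        by (simp add: C_def D_def g)
    next
      case 4
      then show ?thesis
        using adj_entry_C3neg_dot_K(5)[OF n4, of "g v"] S_zero g(5) adj_entry_sym[of ?K "g v" "n - 2"]
        by (simp add: C_def D_def g)
    qed
  qed
  have CD_b: "C b v = D b v" if v: "v \<in> V" for v
  proof -
    consider "v = a" | "v = b" | "v = w" | "v \<in> V - {a, b, w}" using v by blast
    then show ?thesis
    proof cases
      case 1
      then show ?thesis using CD_a[OF abw(2)] C_sym D_sym by metis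
    next
      case 2
      then show ?thesis using C_diag diag by (simp add: D_def)
    next
      case 3
      then show ?thesis
        using adj_entry_C3neg_dot_K(4)[OF n4] S_ab adj_entry_sym[of ?K 0 "n - 1"]
        by (simp add: C_def D_def g)
    next
      case 4
      then show ?thesis
        using adj_entry_C3neg_dot_K(6)[OF n4, of "g v"] S_zero g(5) adj_entry_sym[of ?K "g v" "n - 1"]
        by (simp add: C_def D_def g)
    qed
  qed
  have C_out: "C u v = 1" if uv: "u \<in> V - {a, b}" "v \<in> V - {a, b}" "u \<noteq> v" for u v
  proof -
    have lt: "g u < n - 2" if "u \<in> V - {a, b}" for u
      using that g(2) g(5)[of u] n4 by (cases "u = w") auto
    have "g u \<noteq> g v" using g(1) uv by (auto simp: bij_betw_def inj_on_def)
    then show ?thesis unfolding C_def using lt uv by (intro adj_entry_C3neg_dot_K(1)[OF n4]) auto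
  qed
  have D_le_1: "D u v \<le> 1" for u v
    using entries[of u v] t'[of u] t'[of v] by (auto simp: D_def)
  have CD: "C u v = D u v" if uv: "u \<in> V" "v \<in> V" for u v
  proof (rule ccontr)
    assume neq: "C u v \<noteq> D u v"
    \<comment> \<open>The factor \<open>t'\<close> undoes the switching from \<open>S\<close> to
      \<open>D\<close>, so the quadratic form keeps its value. Where \<open>C\<close> and
      \<open>D\<close> differ, both vertices lie outside \<open>{a, b}\<close>, so \<open>y\<close>
      is positive there and the form strictly increases from \<open>D\<close> to
      \<open>C\<close>.\<close>
    define y where "y v = t' v * x v" for v
    have t'2: "t' v * t' v = 1" for v using t'[of v] by auto
    have y2: "(y v)\<^sup>2 = (x v)\<^sup>2" for v using t'[of v] by (auto simp: y_def)
    have le: "D u v * y u * y v \<le> C u v * y u * y v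
        \<and> (C u v \<noteq> D u v \<longrightarrow> D u v * y u * y v < C u v * y u * y v)" if "u \<in> V" "v \<in> V" for u v
    proof (cases "C u v = D u v")
      case False
      then have uv: "u \<in> V - {a, b}" "v \<in> V - {a, b}"
        using that CD_a CD_b C_sym D_sym by (metis Diff_iff insertE singletonD)+
      have "u \<noteq> v" using False C_diag diag by (auto simp: D_def)
      then have "D u v < C u v" using False D_le_1[of u v] C_out[OF uv] by simp
      moreover have "0 < y u * y v" using t'_out[OF uv(1)] t'_out[OF uv(2)] by (simp add: y_def)
      ultimately have "D u v * (y u * y v) < C u v * (y u * y v)" by (rule mult_strict_right_mono)
      then show ?thesis by (simp add: mult.assoc)
    qed simp
    have "r * (\<Sum>u\<in>V. (x u)\<^sup>2) = (\<Sum>u\<in>V. \<Sum>v\<in>V. S u v * x u * x v)"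
      using quadratic_form_eigenfunction[OF eig] by simp
    also have "\<dots> = (\<Sum>u\<in>V. \<Sum>v\<in>V. D u v * y u * y v)"
    proof (intro sum.cong refl)
      fix u v
      have "D u v * y u * y v = S u v * x u * x v * (t' u * t' u) * (t' v * t' v)"
        by (simp add: D_def y_def mult_ac)
      then show "S u v * x u * x v = D u v * y u * y v" by (simp add: t'2)
    qed
    also have "\<dots> < (\<Sum>u\<in>V. \<Sum>v\<in>V. C u v * y u * y v)"
    proof (rule sum_strict_mono_ex1[OF fin])
      show "\<forall>u\<in>V. (\<Sum>v\<in>V. D u v * y u * y v) \<le> (\<Sum>v\<in>V. C u v * y u * y v)"
        using le by (intro ballI sum_mono) blast
      have "(\<Sum>v\<in>V. D u v * y u * y v) < (\<Sum>v\<in>V. C u v * y u * y v)"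
        using le uv neq by (intro sum_strict_mono_ex1[OF fin]) blast+
      then show "\<exists>u\<in>V. (\<Sum>v\<in>V. D u v * y u * y v) < (\<Sum>v\<in>V. C u v * y u * y v)"
        using uv by blast
    qed
    also have "\<dots> \<le> sg_spectral_radius ?K * (\<Sum>u\<in>V. (y u)\<^sup>2)"
    proof -
      define h where "h i = y (inv_into V g i)" for i
      have h: "h (g v) = y v" if "v \<in> V" for v
        using that g(1) by (simp add: h_def bij_betw_def inv_into_f_f)
      have verts: "sg_verts ?K = {..<n}" by (simp add: C3neg_dot_K_def)
      have reindex: "(\<Sum>i<n. F i) = (\<Sum>u\<in>V. F (g u))" for F :: "nat \<Rightarrow> real"
        using sum.reindex_bij_betw[OF g(1), of F] by simp
      have "(\<Sum>u\<in>V. \<Sum>v\<in>V. C u v * y u * y v)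
          = (\<Sum>i\<in>sg_verts ?K. \<Sum>j\<in>sg_verts ?K. adj_entry ?K i j * h i * h j)"
        unfolding verts reindex C_def by (intro sum.cong refl) (simp add: h)
      also have "\<dots> \<le> sg_spectral_radius ?K * (\<Sum>i\<in>sg_verts ?K. (h i)\<^sup>2)"
        by (rule rayleigh_le_spectral_radius) (use n4 in \<open>auto simp: verts lessThan_empty_iff\<close>)
      also have "(\<Sum>i\<in>sg_verts ?K. (h i)\<^sup>2) = (\<Sum>u\<in>V. (y u)\<^sup>2)"
        unfolding verts reindex by (intro sum.cong refl) (simp add: h)
      finally show ?thesis .
    qed
    also have "\<dots> \<le> r * (\<Sum>u\<in>V. (x u)\<^sup>2)"
      unfolding y2 using large by (intro mult_right_mono) (auto simp: r_def sum_nonneg)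
    finally show False by simp
  qed
  \<comment> \<open>The two switchings, by \<open>t\<close> and then by \<open>t'\<close>, combine
    into one.\<close>
  define U where "U = {v \<in> V. t' v * t v = -1}"
  have "sg_isomorphic (switch U G) ?K"
  proof (rule sg_isomorphicI[OF signed_graph_switch[OF G] signed_graph_C3neg_dot_K[OF n4]])
    show "bij_betw g (sg_verts (switch U G)) (sg_verts ?K)"
      using g(1) by (simp add: V_def C3neg_dot_K_def)
    fix u v assume uv: "u \<in> sg_verts (switch U G)" "v \<in> sg_verts (switch U G)"
    have sgn: "(if v \<in> U then -1 else 1) = t' v * t v" if "v \<in> V" for v
      using that t[of v] t'[of v] by (auto simp: U_def)
    have "adj_entry (switch U G) u v = t' u * t u * A u v * (t' v * t v)"
      using adj_entry_switch[of u G v U] uv sgn[of u] sgn[of v] by (simp add: A_def V_def)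
    also have "\<dots> = D u v" by (simp add: D_def SB B_def mult_ac)
    finally show "adj_entry ?K (g u) (g v) = adj_entry (switch U G) u v"
      using CD[of u v] uv by (simp add: C_def V_def)
  qed
  moreover have "U \<subseteq> sg_verts G" by (auto simp: U_def V_def)
  ultimately show ?thesis unfolding switching_equivalent_def by blast
qed

theorem theorem1p4:
  fixes G :: "'a sgraph" and n k :: nat
  assumes "signed_graph G"
    and "sg_order G = n"
    and "\<not> balanced G"
    and "3 \<le> k" and "real k \<le> (real n - 11) / 10"
    and "negative_cycle_free (2 * k + 1) G"
  shows "sg_spectral_radius G \<le> sg_spectral_radius (C3neg_dot_K n) \<and>
    (sg_spectral_radius G = sg_spectral_radius (C3neg_dot_K n) \<longleftrightarrow>
      switching_equivalent G (C3neg_dot_K n))"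
proof -
  have "real (10 * k + 11) \<le> real n" using assms(5) by simp
  then have "10 * k + 11 \<le> n" by linarith
  then have "switching_equivalent G (C3neg_dot_K n)"
    if "sg_spectral_radius (C3neg_dot_K n) \<le> sg_spectral_radius G"
    using switching_equivalent_if_large_radius assms that by blast
  \<comment> \<open>If the radius of \<open>G\<close> is at least that of the extremal graph, the
    two are switching equivalent and the radii coincide. This excludes a larger radius and settles
    equality.\<close>
  then show ?thesis
    using sg_spectral_radius_switching_equivalent[OF assms(1), of "C3neg_dot_K n"] by fastforce
qed

end
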